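(* Up to monomial equivalence there are exactly ten quasi self-dual codes over $I_5$ of length $3$ and type $\{1,1\}$. Pairwise inequivalent representatives are the codes with the following generator matrices: $$G_1=\begin{pmatrix}0&\mathtt{a}&3\mathtt{a}\\ \mathtt{b}&2\mathtt{b}&\mathtt{b}\end{pmatrix},\quad G_2=\begin{pmatrix}\mathtt{a}&2\mathtt{a}+\mathtt{b}&3\mathtt{b}\\ \mathtt{b}&2\mathtt{b}&\mathtt{b}\end{pmatrix},\quad G_3=\begin{pmatrix}\mathtt{a}&2\mathtt{a}+2\mathtt{b}&\mathtt{b}\\ \mathtt{b}&2\mathtt{b}&\mathtt{b}\end{pmatrix},$$ $$G_4=\begin{pmatrix}\mathtt{a}&2\mathtt{a}&\mathtt{b}\\ 0&\mathtt{b}&0\end{pmatrix},\quad G_5=\begin{pmatrix}\mathtt{a}&2\mathtt{a}&0\\ 0&\mathtt{b}&0\end{pmatrix},\quad G_6=\begin{pmatrix}\mathtt{a}&0&2\mathtt{a}\\ 0&\mathtt{b}&\mathtt{b}\end{pmatrix},$$ $$G_{7},G_8,G_9=\begin{pmatrix}\mathtt{a}&2\mathtt{a}&\mathtt{b}\\ 0&\mathtt{b}&\alpha\end{pmatrix}\ \text{ with }\alpha=\mathtt{b},\,3\mathtt{b},\,4\mathtt{b}\text{ respectively},\quad G_{10}=\begin{pmatrix}\mathtt{a}&2\mathtt{a}&2\mathtt{b}\\ 0&\mathtt{b}&\mathtt{b}\end{pmatrix}.$$ Their automorphism groups have orders $8,4,4,2,8,2,2,2,2,2$ respectively. Their minimum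 distances are $1$ for $G_1,\dots,G_5$ and $2$ for $G_6,\dots,G_{10}$. The numbers $(A_1,A_2,A_3)$ of codewords of weight $1,2,3$ are $(4,24,96)$ for $G_1,G_2,G_3$; $(8,16,100)$ for $G_4$; $(8,116,0)$ for $G_5$; and $(0,32,92)$ for $G_6,\dots,G_{10}$.
   Context: $I_5$ is the commutative ring without unity of order 25 and characteristic 5 generated by $\mathtt{a},\mathtt{b}$ with relations $5\mathtt{a}=5\mathtt{b}=0$, $\mathtt{a}^2=\mathtt{b}$, $\mathtt{a}\mathtt{b}=0$ (hence $\mathtt{b}^2=0$); every element is uniquely $\mathtt{a}x+\mathtt{b}y$ with $x,y\in\mathbb{F}_5$. A linear code of length $n$ over $I_5$ is an $I_5$-submodule of $I_5^n$; the code with generator matrix $G$ is the smallest $I_5$-submodule (additive subgroup closed under multiplication by $I_5$) containing the rows of $G$. Let $\pi:I_5\to\mathbb{F}_5$, $\pi(\mathtt{a}x+\mathtt{b}y)=x$, extended coordinatewise; $\operatorname{res}(\mathcal{C})=\pi(\mathcal{C})$ and $\operatorname{tor}(\mathcal{C})=\{\mathbf{x}\in\mathbb{F}_5^n:\mathtt{b}\mathbf{x}\in\mathcal{C}\}$. $\mathcal{C}$ has type $\{k_1,k_2\}$ if $\dim\operatorname{res}(\mathcal{C})=k_1$ and $\dim\operatorname{tor}(\mathcal{C})=k_1+k_2$. $\mathcal{C}$ is self-orthogonal if $\sum_i y_iz_i=0$ for all $\mathbf{y},\mathbf{z}\in\mathcal{C}$, and quasi self-dual if it is self-orthogonal of size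 $5^n$. Two codes $\mathcal{C},\mathcal{C}'$ of length $n$ are monomially equivalent if $\mathcal{C}'=\{\mathbf{c}M:\mathbf{c}\in\mathcal{C}\}$ for some $n\times n$ monomial matrix $M$ (exactly one nonzero entry in each row and column) with nonzero entries in $\{1,-1\}$; $\operatorname{Aut}(\mathcal{C})$ is the group of such $M$ with $\mathcal{C}M=\mathcal{C}$. The weight of a vector is its number of nonzero coordinates; the minimum distance is the least weight of a nonzero codeword. *)

theory Defs
  imports "HOL-Analysis.Cartesian_Space" "Berlekamp_Zassenhaus.Finite_Field"
begin

section \<open>The field with five elements and the ring \<open>I\<^sub>5\<close>\<close>

text \<open>\<open>'a mod_ring\<close> is the ring of integers modulo \<open>CARD('a)\<close>. It is a field only if \<open>'a\<close> is of class
  \<open>prime_card\<close>, to which the numeral type \<open>5\<close> cannot be added (its outermost type constructor \<open>bit1\<close>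
  covers all odd numbers), hence the auxiliary type \<open>five\<close>.\<close>

typedef five = "{0..<5::nat}" by (rule exI[of _ 0]) simp

lemma CARD_five [simp]: "CARD(five) = 5"
  using type_definition.card[OF type_definition_five] by simp

instance five :: prime_card
  by standard simp

type_synonym f5 = "five mod_ring"

lemma CARD_f5: "CARD(f5) = 5"
  by simp

text \<open>\<open>I5 x y\<close> is the element \<open>\<a>x + \<b>y\<close>. The relations \<open>\<a>\<^sup>2 = \<b>\<close> and \<open>\<a>\<b> = \<b>\<^sup>2 = 0\<close> give
  \<open>(\<a>x + \<b>y)(\<a>x' + \<b>y') = \<b>xx'\<close>. The class \<open>comm_ring\<close> does not include a unity.\<close>

datatype i5 = I5 (pi5: f5) (snd5: f5)

instantiation i5 :: comm_ring
begin

definition "0 = I5 0 0"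
definition "r + s = I5 (pi5 r + pi5 s) (snd5 r + snd5 s)"
definition "- r = I5 (- pi5 r) (- snd5 r)"
definition "r - s = I5 (pi5 r - pi5 s) (snd5 r - snd5 s)"
definition "r * s = I5 0 (pi5 r * pi5 s)"

instance
  by standard
    (simp_all add: zero_i5_def plus_i5_def uminus_i5_def minus_i5_def times_i5_def algebra_simps)

end

definition \<a> :: i5 where "\<a> = I5 1 0"
definition \<b> :: i5 where "\<b> = I5 0 1"

definition scal :: "f5 \<Rightarrow> i5 \<Rightarrow> i5"  (infixr \<open>\<odot>\<close> 75)
  where "k \<odot> r = I5 (k * pi5 r) (k * snd5 r)"

lemma i5_relations:
  "\<a> + \<a> + \<a> + \<a> + \<a> = 0" "\<b> + \<b> + \<b> + \<b> + \<b> = 0"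
  "\<a> * \<a> = \<b>" "\<a> * \<b> = 0" "\<b> * \<b> = 0"
proof -
  have "(1::f5) + 1 + 1 + 1 + 1 = 0"
    by (transfer, simp)
  then show "\<a> + \<a> + \<a> + \<a> + \<a> = 0" "\<b> + \<b> + \<b> + \<b> + \<b> = 0"
    by (simp_all add: \<a>_def \<b>_def plus_i5_def zero_i5_def)
qed (simp_all add: \<a>_def \<b>_def times_i5_def zero_i5_def)

lemma I5_eq: "I5 x y = x \<odot> \<a> + y \<odot> \<b>"
  by (simp add: \<a>_def \<b>_def scal_def plus_i5_def)

lemma i5_unique_representation: "\<exists>!(x, y). r = x \<odot> \<a> + y \<odot> \<b>"
  by (cases r) (auto simp: I5_eq[symmetric])

lemma bij_I5: "bij (\<lambda>(x, y). I5 x y)"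
  by (rule bijI', auto) (metis i5.collapse)

lemma CARD_i5: "CARD(i5) = 25"
  using bij_betw_same_card[OF bij_I5]
  by (simp flip: UNIV_Times_UNIV add: card_cartesian_product)

section \<open>Codes\<close>

definition linear_code :: "(i5 ^ 'n) set \<Rightarrow> bool" where
  "linear_code C \<longleftrightarrow> 0 \<in> C \<and> (\<forall>y\<in>C. \<forall>z\<in>C. y - z \<in> C) \<and> (\<forall>r. \<forall>z\<in>C. r *s z \<in> C)"

definition code :: "i5 ^ 'n ^ 'k \<Rightarrow> (i5 ^ 'n) set" where
  "code G = linear_code hull (rows G)"

definition res :: "(i5 ^ 'n) set \<Rightarrow> (f5 ^ 'n) set" where
  "res C = (\<lambda>c. \<chi> i. pi5 (c $ i)) ` C"

definition tor :: "(i5 ^ 'n) set \<Rightarrow> (f5 ^ 'n) set" where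
  "tor C = {x. (\<chi> i. x $ i \<odot> \<b>) \<in> C}"

text \<open>\<open>vec.dim\<close> of a set is the dimension of its span; for linear \<open>C\<close> the sets \<open>res C\<close> and \<open>tor C\<close>
  are themselves subspaces.\<close>

definition has_type :: "(i5 ^ 'n) set \<Rightarrow> nat \<Rightarrow> nat \<Rightarrow> bool" where
  "has_type C k1 k2 \<longleftrightarrow> vec.dim (res C) = k1 \<and> vec.dim (tor C) = k1 + k2"

definition self_orthogonal :: "(i5 ^ 'n) set \<Rightarrow> bool" where
  "self_orthogonal C \<longleftrightarrow> (\<forall>y\<in>C. \<forall>z\<in>C. (\<Sum>i\<in>UNIV. y $ i * z $ i) = 0)"

definition quasi_self_dual :: "(i5 ^ 'n) set \<Rightarrow> bool" where
  "quasi_self_dual C \<longleftrightarrow> linear_code C \<and> self_orthogonal C \<and> card C = 5 ^ CARD('n)"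

section \<open>Monomial equivalence\<close>

text \<open>As \<open>I\<^sub>5\<close> has no unity, monomial matrices have entries in \<open>\<F>\<^sub>5\<close> (where \<open>1 \<noteq> -1\<close>), acting on
  \<open>I\<^sub>5\<close> as an algebra over \<open>\<F>\<^sub>5\<close>.\<close>

definition monomial :: "f5 ^ 'n ^ 'n \<Rightarrow> bool" where
  "monomial M \<longleftrightarrow>
     (\<forall>i. \<exists>!j. M $ i $ j \<noteq> 0) \<and> (\<forall>j. \<exists>!i. M $ i $ j \<noteq> 0) \<and>
     (\<forall>i j. M $ i $ j \<noteq> 0 \<longrightarrow> M $ i $ j \<in> {1, -1})"

definition mat_act :: "i5 ^ 'n \<Rightarrow> f5 ^ 'n ^ 'n \<Rightarrow> i5 ^ 'n" where
  "mat_act c M = (\<chi> j. \<Sum>i\<in>UNIV. M $ i $ j \<odot> c $ i)"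

definition monomially_equivalent :: "(i5 ^ 'n) set \<Rightarrow> (i5 ^ 'n) set \<Rightarrow> bool" where
  "monomially_equivalent C C' \<longleftrightarrow> (\<exists>M. monomial M \<and> C' = {mat_act c M | c. c \<in> C})"

definition Aut :: "(i5 ^ 'n) set \<Rightarrow> (f5 ^ 'n ^ 'n) set" where
  "Aut C = {M. monomial M \<and> {mat_act c M | c. c \<in> C} = C}"

section \<open>Weights\<close>

definition weight :: "i5 ^ 'n \<Rightarrow> nat" where
  "weight c = card {i. c $ i \<noteq> 0}"

definition min_dist :: "(i5 ^ 'n) set \<Rightarrow> nat" where
  "min_dist C = (LEAST w. \<exists>c\<in>C. c \<noteq> 0 \<and> weight c = w)"

definition num_weight :: "(i5 ^ 'n) set \<Rightarrow> nat \<Rightarrow> nat" where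
  "num_weight C w = card {c \<in> C. weight c = w}"

section \<open>The ten generator matrices\<close>

definition G1 :: "i5 ^ 3 ^ 2" where
  "G1 = vector [vector [0, \<a>, 3 \<odot> \<a>], vector [\<b>, 2 \<odot> \<b>, \<b>]]"
definition G2 :: "i5 ^ 3 ^ 2" where
  "G2 = vector [vector [\<a>, 2 \<odot> \<a> + \<b>, 3 \<odot> \<b>], vector [\<b>, 2 \<odot> \<b>, \<b>]]"
definition G3 :: "i5 ^ 3 ^ 2" where
  "G3 = vector [vector [\<a>, 2 \<odot> \<a> + 2 \<odot> \<b>, \<b>], vector [\<b>, 2 \<odot> \<b>, \<b>]]"
definition G4 :: "i5 ^ 3 ^ 2" where
  "G4 = vector [vector [\<a>, 2 \<odot> \<a>, \<b>], vector [0, \<b>, 0]]"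
definition G5 :: "i5 ^ 3 ^ 2" where
  "G5 = vector [vector [\<a>, 2 \<odot> \<a>, 0], vector [0, \<b>, 0]]"
definition G6 :: "i5 ^ 3 ^ 2" where
  "G6 = vector [vector [\<a>, 0, 2 \<odot> \<a>], vector [0, \<b>, \<b>]]"
definition G7 :: "i5 ^ 3 ^ 2" where
  "G7 = vector [vector [\<a>, 2 \<odot> \<a>, \<b>], vector [0, \<b>, \<b>]]"
definition G8 :: "i5 ^ 3 ^ 2" where
  "G8 = vector [vector [\<a>, 2 \<odot> \<a>, \<b>], vector [0, \<b>, 3 \<odot> \<b>]]"
definition G9 :: "i5 ^ 3 ^ 2" where
  "G9 = vector [vector [\<a>, 2 \<odot> \<a>, \<b>], vector [0, \<b>, 4 \<odot> \<b>]]"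
definition G10 :: "i5 ^ 3 ^ 2" where
  "G10 = vector [vector [\<a>, 2 \<odot> \<a>, 2 \<odot> \<b>], vector [0, \<b>, \<b>]]"

definition codes :: "(i5 ^ 3) set list" where
  "codes = map code [G1, G2, G3, G4, G5, G6, G7, G8, G9, G10]"

end

(*
A quasi self-dual code of type {1,1} has a residue code spanned by an isotropic vector v, and a torsion
code which is a plane {y. h . y = 0} containing v. Writing av + bw for a codeword above v, it is
{a(tv) + by | h . y = t (h . w)}, so it is determined by (v, h, s) with s = h . w. Two such triples give the
same code iff they differ by (v, h, s) |-> (lv, mh, lms) with nonzero l, m. A monomial matrix M is
orthogonal and therefore sends (v, h, s) to (vM, hM, s). Scaling v and h to have leading entry 1 leaves 180
triples, on which the 48 monomial matrices act.
*)

theory Submission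
  imports Defs
begin

section \<open>Codes as pairs of vectors over the field\<close>

text \<open>The only nonzero product of the generators is \<open>\<a> * \<a> = \<b>\<close>. So an
  inner product sees only the residues, and self-orthogonality says that v is isotropic; and
  multiplying a codeword by \<open>\<a>\<close> turns its residue into a torsion word, which puts v
  into the torsion plane. The size 5 * 25 is then automatic. That h is moved by M itself, rather
  than by the inverse transpose, rests on the entries 1 and -1, whose squares are 1.

  The count 180 is 6 * 6 * 5: the conic v . v = 0 has 6 points in the projective plane over the
  field, each line h . v = 0 has 6 points, and s takes 5 values. It agrees with the automorphism
  groups: the orbits have 48 / |Aut| elements, and 6 + 12 + 12 + 24 + 6 + 5 * 24 = 180.

  The obstacle is to make the orbits computable. The relation with unknown factors l and m is
  replaced by equality of normal forms, and the field by a datatype on which the simplifier can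
  evaluate; all remaining claims are then finite tables.\<close>

notation scalar_product (infixl \<open>\<star>\<close> 70)

definition i5vec :: "f5 ^ 'n \<Rightarrow> f5 ^ 'n \<Rightarrow> i5 ^ 'n" where
  "i5vec x y = (\<chi> i. I5 (x $ i) (y $ i))"

lemma i5vec_nth [simp]: "i5vec x y $ i = I5 (x $ i) (y $ i)"
  by (simp add: i5vec_def)

lemma i5vec_eq_iff [simp]: "i5vec x y = i5vec x' y' \<longleftrightarrow> x = x' \<and> y = y'"
  by (auto simp: vec_eq_iff)

lemma i5vec_cases [cases type: vec]:
  fixes c :: "i5 ^ 'n"
  obtains x y where "c = i5vec x y"
proof
  show "c = i5vec (\<chi> i. pi5 (c $ i)) (\<chi> i. snd5 (c $ i))"
    by (simp add: vec_eq_iff)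
qed

lemma i5vec_subsetI:
  assumes "\<And>x y. i5vec x y \<in> A \<Longrightarrow> i5vec x y \<in> B"
  shows "A \<subseteq> B"
proof
  fix c
  assume "c \<in> A"
  with assms show "c \<in> B"
    by (cases c) simp
qed

lemma i5vec_set_eqI: "(\<And>x y. i5vec x y \<in> A \<longleftrightarrow> i5vec x y \<in> B) \<Longrightarrow> A = B"
  by (intro subset_antisym i5vec_subsetI) simp_all

lemma i5vec_0: "0 = i5vec 0 0"
  by (simp add: vec_eq_iff zero_i5_def)

lemma i5vec_eq_0_iff [simp]: "i5vec x y = 0 \<longleftrightarrow> x = 0 \<and> y = 0"
  unfolding i5vec_0 by simp

lemma i5vec_diff: "i5vec x y - i5vec x' y' = i5vec (x - x') (y - y')"
  by (simp add: vec_eq_iff minus_i5_def)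

lemma i5vec_smult: "r *s i5vec x y = i5vec 0 (pi5 r *s x)"
  by (simp add: vec_eq_iff times_i5_def)

lemma res_iff: "x \<in> res C \<longleftrightarrow> (\<exists>y. i5vec x y \<in> C)"
proof
  assume "x \<in> res C"
  then obtain c where "c \<in> C" "x = (\<chi> i. pi5 (c $ i))"
    by (auto simp: res_def)
  then show "\<exists>y. i5vec x y \<in> C"
    by (cases c) (auto simp: vec_lambda_eta)
next
  assume "\<exists>y. i5vec x y \<in> C"
  then show "x \<in> res C"
    unfolding res_def by (force simp: vec_eq_iff image_iff)
qed

lemma tor_iff: "x \<in> tor C \<longleftrightarrow> i5vec 0 x \<in> C"
proof -
  have "(\<chi> i. x $ i \<odot> \<b>) = i5vec 0 x"
    by (simp add: vec_eq_iff scal_def \<b>_def)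
  then show ?thesis
    by (simp add: tor_def)
qed

text \<open>Products involving \<open>\<b>\<close> vanish and \<open>\<a> * \<a> = \<b>\<close>, so
  only the residues contribute.\<close>

lemma inner_i5vec:
  "(\<Sum>i\<in>UNIV. i5vec x y $ i * i5vec x' y' $ i) = I5 0 (x \<star> x')"
proof -
  have "(\<Sum>i\<in>A. i5vec x y $ i * i5vec x' y' $ i) = I5 0 (\<Sum>i\<in>A. x $ i * x' $ i)" if "finite A" for A
    using that by induction (auto simp: times_i5_def plus_i5_def zero_i5_def)
  then show ?thesis
    by (simp add: scalar_product_def)
qed

lemma linear_code_i5vec:
  "linear_code C \<longleftrightarrow> i5vec 0 0 \<in> C
     \<and> (\<forall>x y x' y'. i5vec x y \<in> C \<longrightarrow> i5vec x' y' \<in> C \<longrightarrow> i5vec (x - x') (y - y') \<in> C)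
     \<and> (\<forall>r x y. i5vec x y \<in> C \<longrightarrow> i5vec 0 (r *s x) \<in> C)"
  (is "_ \<longleftrightarrow> ?Z \<and> ?D \<and> ?S")
proof
  assume C: "linear_code C"
  have ?S
  proof (intro allI impI)
    fix r x y
    assume "i5vec x y \<in> C"
    \<comment> \<open>Multiplying by r times \<open>\<a>\<close> moves the residue, scaled by r,
      into the torsion part.\<close>
    then have "I5 r 0 *s i5vec x y \<in> C"
      using C by (auto simp: linear_code_def)
    then show "i5vec 0 (r *s x) \<in> C"
      by (simp add: i5vec_smult)
  qed
  with C show "?Z \<and> ?D \<and> ?S"
    by (auto simp: linear_code_def simp flip: i5vec_0 i5vec_diff)
next
  assume *: "?Z \<and> ?D \<and> ?S"
  have "y - z \<in> C" if "y \<in> C" "z \<in> C" for y z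
    using that * by (cases y; cases z) (auto simp: i5vec_diff)
  moreover have "r *s z \<in> C" if "z \<in> C" for r z
    using that * by (cases z) (simp add: i5vec_smult, blast)
  ultimately show "linear_code C"
    using * by (auto simp: linear_code_def i5vec_0)
qed

text \<open>The ring has no unity, so a field scalar is not one of the module multiplications; it
  acts as repeated addition, since every k is the image of a natural number.\<close>

lemma linear_code_scale:
  assumes "linear_code C" "i5vec x y \<in> C"
  shows "i5vec (k *s x) (k *s y) \<in> C"
proof -
  have diff: "i5vec (x - x') (y - y') \<in> C" if "i5vec x y \<in> C" "i5vec x' y' \<in> C" for x y x' y'
    using assms(1) that by (auto simp: linear_code_i5vec)
  have zero: "i5vec 0 0 \<in> C"
    using assms(1) by (auto simp: linear_code_i5vec)
  have "i5vec (of_nat n *s x) (of_nat n *s y) \<in> C" for n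
  proof (induction n)
    case 0
    then show ?case
      using zero by (simp add: zero_vec_def[symmetric] vector_scalar_mult_def)
  next
    case (Suc n)
    \<comment> \<open>Closure is given for differences only, so the next summand z is added as - (0
      - z).\<close>
    from diff[OF Suc diff[OF zero assms(2)]] show ?case
      by (simp add: vec.scale_left_distrib add.commute)
  qed
  then show ?thesis
    using surj_of_nat_mod_ring[of k] by metis
qed

lemma linear_code_add:
  assumes "linear_code C" "i5vec x y \<in> C" "i5vec x' y' \<in> C"
  shows "i5vec (x + x') (y + y') \<in> C"
proof -
  have "i5vec (x - -1 *s x') (y - -1 *s y') \<in> C"
    using assms linear_code_scale by (metis linear_code_i5vec)
  then show ?thesis
    by (simp add: vector_sneg_minus1[symmetric])
qed

lemma subspace_tor:
  assumes "linear_code C"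
  shows "vec.subspace (tor C)"
proof (rule vec.subspaceI)
  show "0 \<in> tor C"
    using assms unfolding linear_code_i5vec tor_iff by blast
  show "x + x' \<in> tor C" if "x \<in> tor C" "x' \<in> tor C" for x x'
    using that linear_code_add[OF assms, of 0 x 0 x'] by (simp add: tor_iff)
  show "k *s x \<in> tor C" if "x \<in> tor C" for k x
    using that linear_code_scale[OF assms, of 0 x k] by (simp add: tor_iff)
qed

section \<open>Hyperplanes\<close>

lemma scalar_product_add_right: "h \<star> (x + y) = h \<star> x + h \<star> y"
  for h :: "'a :: comm_ring_1 ^ 'n"
  by (simp add: scalar_product_def algebra_simps sum.distrib)

lemma scalar_product_diff_right: "h \<star> (x - y) = h \<star> x - h \<star> y"
  for h :: "'a :: comm_ring_1 ^ 'n"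
  by (simp add: scalar_product_def algebra_simps sum_subtractf)

lemma scalar_product_scale_right: "h \<star> (k *s x) = k * (h \<star> x)"
  for h :: "'a :: comm_ring_1 ^ 'n"
  by (simp add: scalar_product_def algebra_simps sum_distrib_left)

lemma scalar_product_scale_left: "(k *s h) \<star> x = k * (h \<star> x)"
  for h :: "'a :: comm_ring_1 ^ 'n"
  by (simp add: scalar_product_def algebra_simps sum_distrib_left)

lemma scalar_product_0_right [simp]: "h \<star> 0 = 0"
  for h :: "'a :: comm_ring_1 ^ 'n"
  by (simp add: scalar_product_def)

lemma scalar_product_axis: "h \<star> axis j k = h $ j * k"
  for h :: "'a :: comm_ring_1 ^ 'n"
  by (simp add: scalar_product_def axis_def if_distrib cong: if_cong)

lemma scalar_product_surj:
  fixes h :: "'a :: field ^ 'n"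
  assumes "h \<noteq> 0"
  obtains y where "h \<star> y = k"
proof -
  obtain j where "h $ j \<noteq> 0"
    using assms by (auto simp: vec_eq_iff)
  then have "h \<star> axis j (k / h $ j) = k"
    by (simp add: scalar_product_axis)
  then show ?thesis
    by (rule that)
qed

lemma subspace_hyperplane: "vec.subspace {y. h \<star> y = 0}"
  for h :: "'a :: field ^ 'n"
  by (simp add: vec.subspace_def scalar_product_add_right scalar_product_scale_right)

text \<open>A vector b with h \<star> b = 1 spans a complement, because x - (h \<star> x) *s b lies
  in the hyperplane.\<close>

lemma dim_hyperplane:
  fixes h :: "'a :: field ^ 'n"
  assumes "h \<noteq> 0"
  shows "vec.dim {y. h \<star> y = 0} = CARD('n) - 1"
proof -
  obtain b where b: "h \<star> b = 1"
    using scalar_product_surj[OF assms] by blast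
  let ?H = "{y. h \<star> y = 0}"
  have span: "vec.span ?H = ?H"
    using subspace_hyperplane by simp
  have "x \<in> vec.span (insert b ?H)" for x
  proof -
    have "x - (h \<star> x) *s b \<in> ?H"
      by (simp add: scalar_product_diff_right scalar_product_scale_right b)
    then show ?thesis
      unfolding vec.span_insert span by blast
  qed
  then have "vec.dim (insert b ?H) = CARD('n)"
    by (metis vec.dim_eq_full UNIV_eq_I vec.dimension_def card_cart_basis)
  moreover have "b \<notin> vec.span ?H"
    unfolding span by (simp add: b)
  ultimately show ?thesis
    by (simp add: vec.dim_insert)
qed

text \<open>The normal vector comes from a linear map that is zero on a basis of T and fixes some b
  outside T: a row of its matrix at which b has a nonzero coordinate annihilates T but not b.
  Equality of dimensions then turns the inclusion into an equality.\<close>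

lemma hyperplane_of_dim:
  fixes T :: "('a :: field ^ 'n) set"
  assumes "vec.subspace T" "vec.dim T = CARD('n) - 1"
  obtains h where "h \<noteq> 0" "T = {y. h \<star> y = 0}"
proof -
  have "vec.dim T \<noteq> CARD('n)"
    using assms(2) zero_less_card_finite[where 'a='n] by linarith
  then have "T \<noteq> UNIV"
    by (metis vec.dim_UNIV vec.dimension_def card_cart_basis)
  then obtain b where "b \<notin> T"
    by blast
  obtain B where B: "B \<subseteq> T" "vec.independent B" "T \<subseteq> vec.span B"
    using vec.basis_exists[of T] by metis
  have "vec.span B = T"
    using B vec.span_minimal[OF B(1) assms(1)] by (intro subset_antisym)
  then have "vec.independent (insert b B)"
    using \<open>b \<notin> T\<close> B by (simp add: vec.independent_insert)
  then obtain g where g: "Vector_Spaces.linear (*s) (*s) g"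
      "\<forall>x\<in>insert b B. g x = (if x = b then b else 0)"
    using vec.linear_independent_extend[of "insert b B" "\<lambda>x. if x = b then b else 0"] by blast
  have "g b = b" "\<And>x. x \<in> B \<Longrightarrow> g x = 0"
    using g(2) \<open>b \<notin> T\<close> B(1) by auto
  have "b \<noteq> 0"
    using \<open>b \<notin> T\<close> assms(1) by (auto dest: vec.subspace_0)
  then obtain i where i: "b $ i \<noteq> 0"
    by (auto simp: vec_eq_iff)
  define h where "h = matrix g $ i"
  have h: "h \<star> x = g x $ i" for x
  proof -
    have "g x = matrix g *v x"
      using g(1) by (simp add: matrix_works)
    then show ?thesis
      by (simp add: h_def matrix_vector_mult_def scalar_product_def)
  qed
  have "h \<star> b \<noteq> 0"
    by (simp add: h \<open>g b = b\<close> i)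
  then have "h \<noteq> 0"
    by (auto simp: scalar_product_def)
  have "B \<subseteq> {y. h \<star> y = 0}"
    using \<open>\<And>x. x \<in> B \<Longrightarrow> g x = 0\<close> by (auto simp: h)
  then have "T \<subseteq> {y. h \<star> y = 0}"
    using \<open>vec.span B = T\<close> subspace_hyperplane vec.span_minimal by blast
  then have "T = {y. h \<star> y = 0}"
    using assms dim_hyperplane[OF \<open>h \<noteq> 0\<close>] subspace_hyperplane by (intro vec.subspace_dim_equal) auto
  with \<open>h \<noteq> 0\<close> show ?thesis
    by (rule that)
qed

lemma hyperplane_eq_iff:
  fixes h h' :: "'a :: field ^ 'n"
  assumes "h \<noteq> 0" "h' \<noteq> 0"
  shows "{y. h \<star> y = 0} = {y. h' \<star> y = 0} \<longleftrightarrow> (\<exists>m. m \<noteq> 0 \<and> h' = m *s h)"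
proof
  assume eq: "{y. h \<star> y = 0} = {y. h' \<star> y = 0}"
  obtain j where j: "h $ j \<noteq> 0"
    using assms(1) by (auto simp: vec_eq_iff)
  define m where "m = h' $ j / h $ j"
  have "h' $ k = m * h $ k" for k
  proof -
    \<comment> \<open>These test vectors lie in the hyperplane of h; that h' annihilates them forces
      its entries to be proportional to those of h.\<close>
    have "axis k 1 - axis j (h $ k / h $ j) \<in> {y. h \<star> y = 0}"
      using j by (simp add: scalar_product_diff_right scalar_product_axis)
    then have "axis k 1 - axis j (h $ k / h $ j) \<in> {y. h' \<star> y = 0}"
      by (simp add: eq)
    then show ?thesis
      using j by (simp add: scalar_product_diff_right scalar_product_axis m_def field_simps)
  qed
  then have h': "h' = m *s h"
    by (simp add: vec_eq_iff)
  with assms(2) have "m \<noteq> 0"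
    by auto
  with h' show "\<exists>m. m \<noteq> 0 \<and> h' = m *s h"
    by blast
next
  assume "\<exists>m. m \<noteq> 0 \<and> h' = m *s h"
  then show "{y. h \<star> y = 0} = {y. h' \<star> y = 0}"
    by (auto simp: scalar_product_scale_left)
qed

section \<open>Codes of type \<open>{1, n - 2}\<close>\<close>

text \<open>A code with one-dimensional residue, spanned by \<open>v\<close>, and with torsion the hyperplane orthogonal to
  \<open>h\<close> is determined by \<open>v\<close>, \<open>h\<close> and \<open>s = h \<star> w\<close> for any codeword \<open>\<a>v + \<b>w\<close>.\<close>

definition pcode :: "f5 ^ 'n \<Rightarrow> f5 ^ 'n \<Rightarrow> f5 \<Rightarrow> (i5 ^ 'n) set" where
  "pcode v h s = {i5vec (t *s v) y | t y. h \<star> y = t * s}"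

lemma i5vec_in_pcode: "i5vec x y \<in> pcode v h s \<longleftrightarrow> (\<exists>t. x = t *s v \<and> h \<star> y = t * s)"
  by (auto simp: pcode_def)

text \<open>The hypothesis serves closure under the ring: a product with a ring element is
  \<open>\<b>\<close> times a multiple of v, which must be a torsion word.\<close>

lemma linear_pcode:
  assumes "h \<star> v = 0"
  shows "linear_code (pcode v h s)"
  unfolding linear_code_i5vec i5vec_in_pcode
proof (intro conjI allI impI)
  show "\<exists>t. 0 = t *s v \<and> h \<star> 0 = t * s"
    by (rule exI[of _ 0]) simp
next
  fix x y x' y'
  assume "\<exists>t. x = t *s v \<and> h \<star> y = t * s" "\<exists>t. x' = t *s v \<and> h \<star> y' = t * s"
  then obtain t t' where "x = t *s v" "h \<star> y = t * s" "x' = t' *s v" "h \<star> y' = t' * s"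
    by blast
  then have "x - x' = (t - t') *s v \<and> h \<star> (y - y') = (t - t') * s"
    by (simp add: scalar_product_diff_right left_diff_distrib vec.scale_left_diff_distrib)
  then show "\<exists>t. x - x' = t *s v \<and> h \<star> (y - y') = t * s" ..
next
  fix r x y
  assume "\<exists>t. x = t *s v \<and> h \<star> y = t * s"
  with assms show "\<exists>t. 0 = t *s v \<and> h \<star> (r *s x) = t * s"
    by (intro exI[of _ 0]) (auto simp: scalar_product_scale_right)
qed

lemma self_orthogonal_pcode:
  assumes "v \<star> v = 0"
  shows "self_orthogonal (pcode v h s)"
  unfolding self_orthogonal_def pcode_def using assms
  by (auto simp: inner_i5vec scalar_product_scale_left scalar_product_scale_right zero_i5_def
      simp del: i5vec_nth)

lemma res_pcode:
  assumes "h \<noteq> 0"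
  shows "res (pcode v h s) = vec.span {v}"
proof -
  have "\<exists>y. h \<star> y = t * s" for t
    using scalar_product_surj[OF assms] by metis
  then show ?thesis
    unfolding set_eq_iff res_iff i5vec_in_pcode vec.span_singleton image_iff by blast
qed

lemma tor_pcode:
  assumes "v \<noteq> 0"
  shows "tor (pcode v h s) = {y. h \<star> y = 0}"
  using assms by (auto simp: tor_iff i5vec_in_pcode)

text \<open>For length n the dimensions match through 1 + (n - 2) = n - 1; the bound on n keeps the
  subtraction from being truncated.\<close>

lemma has_type_pcode:
  fixes v h :: "f5 ^ 'n"
  assumes "v \<noteq> 0" "h \<noteq> 0" "CARD('n) \<ge> 2"
  shows "has_type (pcode v h s) 1 (CARD('n) - 2)"
  using assms by (simp add: has_type_def res_pcode tor_pcode dim_hyperplane)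

text \<open>Here v is a basis of the residue code, h a normal vector of the torsion code, and a lift
  w of v supplies s. Codewords with the same residue differ by a torsion word, so these data
  determine the code.\<close>

lemma pcode_exists:
  fixes C :: "(i5 ^ 'n) set"
  assumes C: "linear_code C" "self_orthogonal C" "has_type C 1 (CARD('n) - 2)" and n: "CARD('n) \<ge> 2"
  obtains v h s where "v \<noteq> 0" "h \<noteq> 0" "v \<star> v = 0" "h \<star> v = 0" "C = pcode v h s"
proof -
  have "vec.dim (tor C) = CARD('n) - 1"
    using C(3) n by (simp add: has_type_def)
  then obtain h where h: "h \<noteq> 0" "tor C = {y. h \<star> y = 0}"
    using hyperplane_of_dim[OF subspace_tor[OF C(1)]] by blast
  have "vec.dim (res C) = 1"
    using C(3) by (simp add: has_type_def)
  obtain B where B: "B \<subseteq> res C" "vec.independent B" "res C \<subseteq> vec.span B" "card B = vec.dim (res C)"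
    using vec.basis_exists[of "res C"] by metis
  then obtain v where "B = {v}"
    using \<open>vec.dim (res C) = 1\<close> by (metis card_1_singletonE)
  with B have v: "v \<noteq> 0" "v \<in> res C" "res C \<subseteq> vec.span {v}"
    by auto
  then obtain w where w: "i5vec v w \<in> C"
    by (auto simp: res_iff)
  have "h \<star> v = 0"
  proof -
    \<comment> \<open>This is \<open>\<a>\<close> times the lift of v.\<close>
    have "i5vec 0 (1 *s v) \<in> C"
      using C(1) w by (metis linear_code_i5vec)
    then show ?thesis
      using h(2) by (simp add: tor_iff set_eq_iff)
  qed
  have "v \<star> v = 0"
    using C(2) w inner_i5vec[of v w v w] unfolding self_orthogonal_def zero_i5_def by (metis i5.inject)
  have tor: "i5vec 0 y \<in> C \<longleftrightarrow> h \<star> y = 0" for y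
    using h(2) by (simp add: tor_iff set_eq_iff)
  have tw: "i5vec (t *s v) (t *s w) \<in> C" for t
    using linear_code_scale[OF C(1) w] .
  have diff: "i5vec (x - x') (y - y') \<in> C" if "i5vec x y \<in> C" "i5vec x' y' \<in> C" for x y x' y'
    using C(1) that by (auto simp: linear_code_i5vec)
  have in_C: "i5vec (t *s v) y \<in> C \<longleftrightarrow> h \<star> y = t * (h \<star> w)" for t y
  proof -
    have "i5vec (t *s v) y \<in> C \<longleftrightarrow> i5vec 0 (y - t *s w) \<in> C"
      using diff[OF _ tw[of t], of "t *s v" y] linear_code_add[OF C(1) _ tw[of t], of 0 "y - t *s w"]
      by auto
    then show ?thesis
      by (simp add: tor scalar_product_diff_right scalar_product_scale_right)
  qed
  have "c \<in> C \<longleftrightarrow> c \<in> pcode v h (h \<star> w)" for c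
  proof (cases c)
    case (1 x y)
    have "i5vec x y \<in> C \<Longrightarrow> \<exists>t. x = t *s v"
      using v(3) by (auto simp: subset_iff res_iff vec.span_singleton)
    then show ?thesis
      unfolding 1 i5vec_in_pcode using in_C by metis
  qed
  then have "C = pcode v h (h \<star> w)"
    by blast
  then show ?thesis
    using that h(1) v(1) \<open>h \<star> v = 0\<close> \<open>v \<star> v = 0\<close> by blast
qed

text \<open>The residue and torsion codes fix v and h up to factors l and m. A value h \<star> y of
  a codeword over v is linear in both, so s picks up the product of the factors.\<close>

lemma pcode_eq_iff:
  assumes "v \<noteq> 0" "h \<noteq> 0" "v' \<noteq> 0" "h' \<noteq> 0"
  shows "pcode v h s = pcode v' h' s' \<longleftrightarrow>
    (\<exists>l m. l \<noteq> 0 \<and> m \<noteq> 0 \<and> v' = l *s v \<and> h' = m *s h \<and> s' = l * m * s)"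
proof
  assume eq: "pcode v h s = pcode v' h' s'"
  then have "{y. h \<star> y = 0} = {y. h' \<star> y = 0}"
    using assms tor_pcode by metis
  then obtain m where m: "m \<noteq> 0" "h' = m *s h"
    using hyperplane_eq_iff assms by metis
  \<comment> \<open>A codeword over v' itself, with parameter t = 1; its parameter with respect to v
    is the factor l.\<close>
  obtain y where y: "h' \<star> y = s'"
    using scalar_product_surj assms(4) by blast
  then have "i5vec v' y \<in> pcode v' h' s'"
    unfolding i5vec_in_pcode by (intro exI[of _ 1]) simp
  then obtain l where l: "v' = l *s v" "h \<star> y = l * s"
    using eq i5vec_in_pcode by metis
  moreover have "l \<noteq> 0"
    using l assms(3) by auto
  moreover have "s' = l * m * s"
    using y l(2) m by (auto simp: scalar_product_scale_left)
  ultimately show "\<exists>l m. l \<noteq> 0 \<and> m \<noteq> 0 \<and> v' = l *s v \<and> h' = m *s h \<and> s' = l * m * s"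
    using m by blast
next
  assume "\<exists>l m. l \<noteq> 0 \<and> m \<noteq> 0 \<and> v' = l *s v \<and> h' = m *s h \<and> s' = l * m * s"
  then obtain l m where lm: "l \<noteq> 0" "m \<noteq> 0" "v' = l *s v" "h' = m *s h" "s' = l * m * s"
    by blast
  have "(\<exists>t. x = t *s v \<and> h \<star> y = t * s) \<longleftrightarrow> (\<exists>t. x = t *s v' \<and> h' \<star> y = t * s')" for x y
  proof
    assume "\<exists>t. x = t *s v \<and> h \<star> y = t * s"
    then obtain t where "x = t *s v" "h \<star> y = t * s"
      by blast
    with lm show "\<exists>t. x = t *s v' \<and> h' \<star> y = t * s'"
      by (intro exI[of _ "t / l"]) (simp add: scalar_product_scale_left)
  next
    assume "\<exists>t. x = t *s v' \<and> h' \<star> y = t * s'"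
    then obtain t where "x = t *s v'" "h' \<star> y = t * s'"
      by blast
    with lm show "\<exists>t. x = t *s v \<and> h \<star> y = t * s"
      by (intro exI[of _ "t * l"]) (simp add: scalar_product_scale_left)
  qed
  then have "i5vec x y \<in> pcode v h s \<longleftrightarrow> i5vec x y \<in> pcode v' h' s'" for x y
    by (simp add: i5vec_in_pcode)
  then show "pcode v h s = pcode v' h' s'"
    by (rule i5vec_set_eqI)
qed

text \<open>\<open>\<a>\<close> times the first row is the torsion word with vector v, and v
  together with u spans the hyperplane. So removing t times the first row from a word of
  \<open>pcode\<close> leaves a word that every linear code containing the rows already has.\<close>

lemma code_eq_pcode:
  fixes G :: "i5 ^ 'n ^ 2"
  assumes G: "G $ 1 = i5vec v w" "G $ 2 = i5vec 0 u"
    and orth: "h \<star> v = 0" "h \<star> u = 0"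
    and H: "{y. h \<star> y = 0} \<subseteq> vec.span {v, u}"
  shows "code G = pcode v h (h \<star> w)"
  unfolding code_def
proof (rule hull_unique)
  have rows: "rows G = {i5vec v w, i5vec 0 u}"
    by (auto simp: rows_def row_def UNIV_2 simp flip: G)
  show "rows G \<subseteq> pcode v h (h \<star> w)"
  proof -
    have "\<exists>t. v = t *s v \<and> h \<star> w = t * (h \<star> w)"
      by (rule exI[of _ 1]) simp
    moreover have "\<exists>t. 0 = t *s v \<and> h \<star> u = t * (h \<star> w)"
      by (rule exI[of _ 0]) (simp add: orth)
    ultimately show ?thesis
      by (simp add: rows i5vec_in_pcode del: vec.scale_eq_0_iff)
  qed
  show "linear_code (pcode v h (h \<star> w))"
    using orth(1) by (rule linear_pcode)
  fix C
  assume "rows G \<subseteq> C" and C: "linear_code C"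
  then have vw: "i5vec v w \<in> C" and u: "i5vec 0 u \<in> C"
    by (auto simp: rows)
  have v: "i5vec 0 (k *s v) \<in> C" for k
    using C vw unfolding linear_code_i5vec by blast
  have u': "i5vec 0 (k *s u) \<in> C" for k
    using linear_code_scale[OF C u, of k] by simp
  have "i5vec x y \<in> C" if "i5vec x y \<in> pcode v h (h \<star> w)" for x y
  proof -
    obtain t where t: "x = t *s v" "h \<star> y = t * (h \<star> w)"
      using \<open>i5vec x y \<in> pcode v h (h \<star> w)\<close> by (auto simp: i5vec_in_pcode)
    then have "h \<star> (y - t *s w) = 0"
      by (simp add: scalar_product_diff_right scalar_product_scale_right)
    then have "y - t *s w \<in> vec.span {v, u}"
      using H by blast
    then obtain p q where "y - t *s w = p *s v + q *s u"
      by (auto simp: vec.span_insert[of v] vec.span_singleton diff_eq_eq add.commute)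
    then have "y = (p *s v + q *s u) + t *s w"
      by (simp add: algebra_simps)
    then show ?thesis
      using linear_code_add[OF C linear_code_add[OF C v u'] linear_code_scale[OF C vw, of t], of p q] t(1) by simp
  qed
  then show "pcode v h (h \<star> w) \<subseteq> C"
    by (rule i5vec_subsetI)
qed

section \<open>Monomial matrices\<close>

lemma axis_nth_neq_0 [simp]: "axis j e $ k \<noteq> 0 \<longleftrightarrow> k = j \<and> e \<noteq> 0"
  by (simp add: axis_def)

text \<open>Two signed unit rows supported in the same column have product 1 or -1, so orthogonality
  of the rows makes the column map injective, hence bijective. This form is decided by dot products
  and is stable under isometries.\<close>

lemma monomial_iff_rows:
  fixes M :: "f5 ^ 'n ^ 'n"
  shows "monomial M \<longleftrightarrow>
    (\<forall>i. \<exists>j. \<exists>e\<in>{1, -1}. M $ i = axis j e) \<and> (\<forall>i k. i \<noteq> k \<longrightarrow> M $ i \<star> M $ k = 0)"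
    (is "_ \<longleftrightarrow> ?A \<and> ?O")
proof
  assume M: "monomial M"
  have row: "\<exists>e\<in>{1, -1}. M $ i = axis j e" if "M $ i $ j \<noteq> 0" for i j
  proof
    show "M $ i $ j \<in> {1, -1}"
      using M that by (simp add: monomial_def)
    have "M $ i $ k = 0" if "k \<noteq> j" for k
      using M that \<open>M $ i $ j \<noteq> 0\<close> unfolding monomial_def by metis
    then show "M $ i = axis j (M $ i $ j)"
      by (simp add: vec_eq_iff axis_def)
  qed
  moreover have nonzero: "\<exists>j. M $ i $ j \<noteq> 0" for i
    using M unfolding monomial_def by metis
  ultimately have ?A
    by blast
  moreover have ?O
  proof (intro allI impI)
    fix i k :: 'n
    assume "i \<noteq> k"
    obtain j e where j: "M $ k = axis j e" "e \<in> {1, -1}"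
      using nonzero row by metis
    then have "M $ k $ j \<noteq> 0"
      by auto
    with \<open>i \<noteq> k\<close> have "M $ i $ j = 0"
      using M unfolding monomial_def by metis
    then show "M $ i \<star> M $ k = 0"
      by (simp add: j scalar_product_axis)
  qed
  ultimately show "?A \<and> ?O" ..
next
  assume *: "?A \<and> ?O"
  then obtain p where "\<forall>i. \<exists>e\<in>{1, -1}. M $ i = axis (p i) e"
    by metis
  then obtain e where pe: "\<And>i. e i \<in> {1, -1}" "\<And>i. M $ i = axis (p i) (e i)"
    by metis
  have e: "e i \<noteq> 0" for i
    using pe(1)[of i] by auto
  have "inj p"
  proof (rule injI, rule ccontr)
    fix i k
    assume "p i = p k" "i \<noteq> k"
    with * have "axis (p k) (e i) \<star> axis (p k) (e k) = 0"
      by (metis pe(2))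
    then show False
      using e by (simp add: scalar_product_axis)
  qed
  then have "bij p"
    by (simp add: bij_betw_def finite_UNIV_inj_surj)
  show "monomial M"
    unfolding monomial_def pe(2) axis_nth_neq_0
  proof (intro conjI allI impI)
    show "\<exists>!j. j = p i \<and> e i \<noteq> 0" for i
      using e by blast
    show "\<exists>!i. j = p i \<and> e i \<noteq> 0" for j
      using \<open>bij p\<close> e by (metis bij_pointE)
    show "axis (p i) (e i) $ j \<in> {1, -1}" if "j = p i \<and> e i \<noteq> 0" for i j
      using pe(1)[of i] that by (simp add: axis_def)
  qed
qed

lemma monomial_transpose: "monomial M \<Longrightarrow> monomial (transpose M)"
  by (simp add: monomial_def transpose_def)

lemma monomial_orthogonal:
  assumes "monomial M"
  shows "M ** transpose M = mat 1"
proof -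
  have "M $ i \<star> M $ k = (if i = k then 1 else 0)" for i k
  proof (cases "i = k")
    case True
    obtain j e where "M $ i = axis j e" "e \<in> {1, -1}"
      using assms by (metis monomial_iff_rows)
    with True show ?thesis
      by (auto simp: scalar_product_axis)
  next
    case False
    with assms show ?thesis
      by (simp add: monomial_iff_rows)
  qed
  then show ?thesis
    by (simp add: vec_eq_iff matrix_matrix_mult_def transpose_def mat_def scalar_product_def)
qed

lemma monomial_orthogonal': "monomial M \<Longrightarrow> transpose M ** M = mat 1"
  using monomial_orthogonal[OF monomial_transpose] by (simp add: transpose_transpose)

lemma scalar_product_vector_matrix: "(x v* M) \<star> y = x \<star> (y v* transpose M)"
  for M :: "'a :: comm_ring_1 ^ 'm ^ 'n"
proof -
  have "(x v* M) \<star> y = (\<Sum>j\<in>UNIV. \<Sum>i\<in>UNIV. x $ i * M $ i $ j * y $ j)"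
    by (simp add: scalar_product_def vector_matrix_mult_def sum_distrib_right)
  also have "\<dots> = (\<Sum>i\<in>UNIV. \<Sum>j\<in>UNIV. x $ i * M $ i $ j * y $ j)"
    by (rule sum.swap)
  also have "\<dots> = x \<star> (y v* transpose M)"
    by (simp add: scalar_product_def matrix_vector_mult_def sum_distrib_left mult.assoc)
  finally show ?thesis .
qed

lemma vector_matrix_transpose_cancel:
  assumes "monomial M"
  shows "x v* M v* transpose M = x" "x v* transpose M v* M = x"
  using assms by (simp_all only: vector_matrix_mul_assoc monomial_orthogonal monomial_orthogonal'
      vector_matrix_mul_rid)

lemma monomial_isometry:
  assumes "monomial M"
  shows "(x v* M) \<star> (y v* M) = x \<star> y"
  by (simp only: scalar_product_vector_matrix vector_matrix_transpose_cancel(1)[OF assms])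

lemma monomial_mat_1: "monomial (mat 1)"
  by (auto simp: monomial_def mat_def)

text \<open>A signed unit row times N is a signed row of N, and N, being an isometry, keeps the rows
  of M orthogonal.\<close>

lemma monomial_mult:
  assumes "monomial M" "monomial N"
  shows "monomial (M ** N)"
  unfolding monomial_iff_rows
proof (intro conjI allI impI)
  have row: "(M ** N) $ i = M $ i v* N" for i
    by (simp add: vec_eq_iff matrix_matrix_mult_def vector_matrix_mult_def)
  fix i
  obtain j e where je: "M $ i = axis j e" "e \<in> {1, -1}"
    using assms(1) by (metis monomial_iff_rows)
  obtain k f where kf: "N $ j = axis k f" "f \<in> {1, -1}"
    using assms(2) by (metis monomial_iff_rows)
  have "axis j e v* N = e *s N $ j"
    by (simp add: vec_eq_iff vector_matrix_mult_def axis_def if_distrib[of "\<lambda>x. x * _"] cong: if_cong)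
  then have "(M ** N) $ i = axis k (e * f)"
    by (simp add: row je kf vec_eq_iff axis_def)
  moreover have "e * f \<in> {1, -1}"
    using je kf by auto
  ultimately show "\<exists>j. \<exists>e\<in>{1, -1}. (M ** N) $ i = axis j e"
    by blast
  show "(M ** N) $ i \<star> (M ** N) $ k = 0" if "i \<noteq> k" for k
    unfolding row monomial_isometry[OF assms(2)] using assms(1) that by (simp add: monomial_iff_rows)
qed

section \<open>Monomial equivalence\<close>

lemma mat_act_i5vec: "mat_act (i5vec x y) M = i5vec (x v* M) (y v* M)"
proof -
  have "(\<Sum>i\<in>A. I5 (f i) (g i)) = I5 (sum f A) (sum g A)" if "finite A" for A :: "'a set" and f g
    using that by induction (simp_all add: zero_i5_def plus_i5_def)
  then show ?thesis
    by (simp add: vec_eq_iff mat_act_def scal_def vector_matrix_mult_def mult.commute)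
qed

lemma mat_act_mat_1: "mat_act c (mat 1) = c"
  by (cases c) (simp add: mat_act_i5vec)

lemma mat_act_mult: "mat_act (mat_act c M) N = mat_act c (M ** N)"
  by (cases c) (simp add: mat_act_i5vec vector_matrix_mul_assoc)

lemma monomially_equivalent_iff:
  "monomially_equivalent C C' \<longleftrightarrow> (\<exists>M. monomial M \<and> C' = (\<lambda>c. mat_act c M) ` C)"
  by (simp add: monomially_equivalent_def Setcompr_eq_image)

text \<open>Symmetry comes from the transpose, which inverts a monomial matrix.\<close>

lemma equiv_monomially_equivalent: "equiv UNIV {(C, C'). monomially_equivalent C C'}"
proof (rule equivI)
  show "{(C, C'). monomially_equivalent C C'} \<subseteq> UNIV \<times> UNIV"
    by simp
  show "refl {(C, C'). monomially_equivalent C C'}"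
    unfolding refl_on_def monomially_equivalent_iff
    by (auto intro!: exI[of _ "mat 1"] simp: monomial_mat_1 mat_act_mat_1)
  show "sym {(C, C'). monomially_equivalent C C'}"
  proof (rule symI, clarify)
    fix C C' :: "(i5 ^ 'n) set"
    assume "monomially_equivalent C C'"
    then obtain M where M: "monomial M" "C' = (\<lambda>c. mat_act c M) ` C"
      by (auto simp: monomially_equivalent_iff)
    then have "C = (\<lambda>c. mat_act c (transpose M)) ` C'"
      by (simp add: image_image mat_act_mult monomial_orthogonal mat_act_mat_1)
    then show "monomially_equivalent C' C"
      using M(1) monomial_transpose monomially_equivalent_iff by blast
  qed
  show "trans {(C, C'). monomially_equivalent C C'}"
  proof (rule transI, clarify)
    fix C C' C'' :: "(i5 ^ 'n) set"
    assume "monomially_equivalent C C'" "monomially_equivalent C' C''"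
    then obtain M N where "monomial M" "C' = (\<lambda>c. mat_act c M) ` C"
        "monomial N" "C'' = (\<lambda>c. mat_act c N) ` C'"
      by (auto simp: monomially_equivalent_iff)
    then have "monomial (M ** N)" "C'' = (\<lambda>c. mat_act c (M ** N)) ` C"
      by (simp_all add: image_image mat_act_mult monomial_mult)
    then show "monomially_equivalent C C''"
      using monomially_equivalent_iff by blast
  qed
qed

lemma pcode_image:
  assumes "monomial M"
  shows "(\<lambda>c. mat_act c M) ` pcode v h s = pcode (v v* M) (h v* M) s"
proof
  show "(\<lambda>c. mat_act c M) ` pcode v h s \<subseteq> pcode (v v* M) (h v* M) s"
  proof (rule image_subsetI)
    fix c
    assume "c \<in> pcode v h s"
    then obtain t y where c: "c = i5vec (t *s v) y" "h \<star> y = t * s"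
      by (auto simp: pcode_def)
    then show "mat_act c M \<in> pcode (v v* M) (h v* M) s"
      unfolding c(1) mat_act_i5vec i5vec_in_pcode
      by (intro exI[of _ t]) (simp add: monomial_isometry[OF assms] scalar_vector_matrix_assoc)
  qed
  show "pcode (v v* M) (h v* M) s \<subseteq> (\<lambda>c. mat_act c M) ` pcode v h s"
  proof
    fix c
    assume "c \<in> pcode (v v* M) (h v* M) s"
    then obtain t z where c: "c = i5vec (t *s (v v* M)) z" "(h v* M) \<star> z = t * s"
      by (auto simp: pcode_def)
    \<comment> \<open>The preimage of z under M.\<close>
    let ?y = "z v* transpose M"
    have "i5vec (t *s v) ?y \<in> pcode v h s"
      using c(2) unfolding i5vec_in_pcode scalar_product_vector_matrix by blast
    moreover have "c = mat_act (i5vec (t *s v) ?y) M"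
      unfolding c(1) mat_act_i5vec vector_matrix_transpose_cancel(2)[OF assms]
      by (simp add: scalar_vector_matrix_assoc)
    ultimately show "c \<in> (\<lambda>c. mat_act c M) ` pcode v h s"
      by blast
  qed
qed

section \<open>A computable copy of the field\<close>

text \<open>The operations are given by equations that the simplifier evaluates in few steps.\<close>

datatype z5 = Z0 | Z1 | Z2 | Z3 | Z4

fun succ5 :: "z5 \<Rightarrow> z5" where
  "succ5 Z0 = Z1" | "succ5 Z1 = Z2" | "succ5 Z2 = Z3" | "succ5 Z3 = Z4" | "succ5 Z4 = Z0"

instantiation z5 :: "{zero, one, plus, uminus, minus, times}"
begin

definition "0 = Z0"

definition "1 = Z1"

fun plus_z5 :: "z5 \<Rightarrow> z5 \<Rightarrow> z5" where
  "Z0 + y = y" | "Z1 + y = succ5 y" | "Z2 + y = succ5 (succ5 y)" | "Z3 + y = succ5 (succ5 (succ5 y))"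
| "Z4 + y = succ5 (succ5 (succ5 (succ5 y)))"

fun uminus_z5 :: "z5 \<Rightarrow> z5" where
  "- Z0 = Z0" | "- Z1 = Z4" | "- Z2 = Z3" | "- Z3 = Z2" | "- Z4 = Z1"

definition "x - y = x + (- y :: z5)"

fun times_z5 :: "z5 \<Rightarrow> z5 \<Rightarrow> z5" where
  "Z0 * y = Z0" | "Z1 * y = y" | "Z2 * y = y + y" | "Z3 * y = - (y + y)" | "Z4 * y = - y"

instance ..

end

text \<open>The value at \<open>Z0\<close> follows the convention that the inverse of 0 is 0, so
  \<open>emb\<close> respects inversion without a side condition.\<close>

fun inv5 :: "z5 \<Rightarrow> z5" where
  "inv5 Z0 = Z0" | "inv5 Z1 = Z1" | "inv5 Z2 = Z3" | "inv5 Z3 = Z2" | "inv5 Z4 = Z4"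

fun emb :: "z5 \<Rightarrow> f5" where
  "emb Z0 = 0" | "emb Z1 = 1" | "emb Z2 = 2" | "emb Z3 = 3" | "emb Z4 = 4"

lemma of_nat_f5_eq_iff: "(of_nat m :: f5) = of_nat n \<longleftrightarrow> m mod 5 = n mod 5"
  by (simp add: of_nat_eq_iff_cong_CHAR cong_def)

lemma emb_of_nat: "emb x = of_nat (case x of Z0 \<Rightarrow> 0 | Z1 \<Rightarrow> 1 | Z2 \<Rightarrow> 2 | Z3 \<Rightarrow> 3 | Z4 \<Rightarrow> 4)"
  by (cases x) simp_all

lemma emb_eq_iff [simp]: "emb x = emb y \<longleftrightarrow> x = y"
  unfolding emb_of_nat of_nat_f5_eq_iff by (cases x; cases y) simp_all

lemma emb_eq_0_iff [simp]: "emb x = 0 \<longleftrightarrow> x = Z0"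
  using emb_eq_iff[of x Z0] by simp

lemma five_eq_0: "(5 :: f5) = 0"
  using of_nat_f5_eq_iff[of 5 0] by simp

lemma emb_succ5: "emb (succ5 x) = emb x + 1"
  by (cases x) (simp_all add: five_eq_0)

lemma emb_add [simp]: "emb (x + y) = emb x + emb y"
  by (cases x) (simp_all add: emb_succ5)

lemma emb_uminus [simp]: "emb (- x) = - emb x"
proof -
  have "x + - x = Z0"
    by (cases x) simp_all
  then have "emb x + emb (- x) = 0"
    by (metis emb.simps(1) emb_add)
  then show ?thesis
    by (simp add: eq_neg_iff_add_eq_0 add.commute)
qed

lemma emb_diff [simp]: "emb (x - y) = emb x - emb y"
  by (simp add: minus_z5_def)

lemma emb_times [simp]: "emb (x * y) = emb x * emb y"
proof -
  have "(3 :: f5) = - 2" "(4 :: f5) = - 1"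
    using five_eq_0 by (simp_all add: eq_neg_iff_add_eq_0)
  then show ?thesis
    by (cases x) simp_all
qed

lemma emb_inv5 [simp]: "emb (inv5 x) = inverse (emb x)"
proof (cases "x = Z0")
  case False
  then have "x * inv5 x = Z1"
    by (cases x) simp_all
  then have "emb x * emb (inv5 x) = 1"
    by (metis emb.simps(2) emb_times)
  then show ?thesis
    by (metis inverse_unique)
qed simp

definition all_z5 :: "z5 list" where "all_z5 = [Z0, Z1, Z2, Z3, Z4]"

lemma in_all_z5 [simp]: "x \<in> set all_z5"
  by (cases x) (simp_all add: all_z5_def)

lemma distinct_all_z5: "distinct all_z5"
  by (simp add: all_z5_def)

text \<open>An injection between two types of five elements.\<close>

lemma emb_surj: obtains k where "x = emb k"
proof -
  have "set all_z5 = UNIV"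
    by auto
  then have "CARD(z5) = 5"
    using distinct_card[OF distinct_all_z5] by (simp add: all_z5_def)
  then have "card (range emb) = CARD(f5)"
    by (subst card_image) (simp_all add: inj_on_def)
  then have "range emb = UNIV"
    by (simp add: card_eq_UNIV_imp_eq_UNIV)
  then show ?thesis
    using that by (metis rangeE UNIV_I)
qed

section \<open>Vectors of length three and parameters over the copy\<close>

type_synonym vec3 = "z5 \<times> z5 \<times> z5"

definition all_vec3 :: "vec3 list" where "all_vec3 = List.product all_z5 (List.product all_z5 all_z5)"

lemma in_all_vec3 [simp]: "x \<in> set all_vec3"
  by (cases x) (simp add: all_vec3_def)

lemma distinct_all_vec3: "distinct all_vec3"
  by (simp add: all_vec3_def distinct_product distinct_all_z5)

definition vec_of :: "vec3 \<Rightarrow> f5 ^ 3" where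
  "vec_of = (\<lambda>(x, y, z). vector [emb x, emb y, emb z])"

lemma vec_of_nth [simp]:
  "vec_of (x, y, z) $ 1 = emb x" "vec_of (x, y, z) $ 2 = emb y" "vec_of (x, y, z) $ 3 = emb z"
  by (simp_all add: vec_of_def)

lemma vec_of_eq_iff [simp]: "vec_of x = vec_of y \<longleftrightarrow> x = y"
  by (cases x; cases y) (simp add: vec_eq_iff forall_3)

lemma vec_of_surj: obtains t where "x = vec_of t"
proof -
  obtain a b c where "x $ 1 = emb a" "x $ 2 = emb b" "x $ 3 = emb c"
    using emb_surj by metis
  then have "x = vec_of (a, b, c)"
    by (simp add: vec_eq_iff forall_3)
  then show ?thesis
    by (rule that)
qed

fun dot :: "vec3 \<Rightarrow> vec3 \<Rightarrow> z5" where
  "dot (x, y, z) (x', y', z') = x * x' + y * y' + z * z'"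

fun scale :: "z5 \<Rightarrow> vec3 \<Rightarrow> vec3" where
  "scale k (x, y, z) = (k * x, k * y, k * z)"

fun cross :: "vec3 \<Rightarrow> vec3 \<Rightarrow> vec3" where
  "cross (x, y, z) (x', y', z') = (y * z' - z * y', z * x' - x * z', x * y' - y * x')"

abbreviation zero3 :: vec3 where "zero3 \<equiv> (Z0, Z0, Z0)"

lemma vec_of_eq_0_iff: "vec_of x = 0 \<longleftrightarrow> x = zero3"
  by (cases x) (simp add: vec_eq_iff forall_3)

lemma vec_of_dot: "vec_of x \<star> vec_of y = emb (dot x y)"
  by (cases x; cases y) (simp add: scalar_product_def sum_3)

lemma vec_of_dot_eq_0_iff: "vec_of x \<star> vec_of y = 0 \<longleftrightarrow> dot x y = Z0"
  by (simp add: vec_of_dot)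

lemma vec_of_scale: "vec_of (scale k x) = emb k *s vec_of x"
  by (cases x) (simp add: vec_eq_iff forall_3)

text \<open>A parameter \<open>(v, h, s)\<close> stands for the code \<open>pcode (vec_of v) (vec_of h) s\<close>.\<close>

type_synonym param = "vec3 \<times> vec3 \<times> z5"

fun param_code :: "param \<Rightarrow> (i5 ^ 3) set" where
  "param_code (v, h, s) = pcode (vec_of v) (vec_of h) (emb s)"

fun proper :: "param \<Rightarrow> bool" where
  "proper (v, h, s) \<longleftrightarrow> v \<noteq> zero3 \<and> h \<noteq> zero3 \<and> dot v v = Z0 \<and> dot h v = Z0"

lemma qsd_type_param_code:
  assumes "quasi_self_dual C" "has_type C 1 1"
  shows "\<exists>t. proper t \<and> C = param_code t"
proof -
  obtain v h s where C: "v \<noteq> 0" "h \<noteq> 0" "v \<star> v = 0" "h \<star> v = 0" "C = pcode v h s"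
    using pcode_exists[of C] assms by (auto simp: quasi_self_dual_def)
  obtain v' h' s' where "v = vec_of v'" "h = vec_of h'" "s = emb s'"
    using vec_of_surj emb_surj by metis
  with C show ?thesis
    by (intro exI[of _ "(v', h', s')"]) (simp add: vec_of_dot_eq_0_iff vec_of_eq_0_iff)
qed

section \<open>Normal forms\<close>

text \<open>Scaling \<open>v\<close> and \<open>h\<close> to have first nonzero entry 1 makes parameters unique.\<close>

definition leading :: "f5 ^ 3 \<Rightarrow> f5" where
  "leading x = (if x $ 1 \<noteq> 0 then x $ 1 else if x $ 2 \<noteq> 0 then x $ 2 else x $ 3)"

lemma leading_eq_0_iff: "leading x = 0 \<longleftrightarrow> x = 0"
  by (auto simp: leading_def vec_eq_iff forall_3)

lemma leading_scale: "leading (k *s x) = k * leading x"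
  by (auto simp: leading_def)

text \<open>The factors l and m can only be the quotients of the leading entries, so dividing by the
  leading entries eliminates the existential quantifier; s is divided by both.\<close>

lemma pcode_eq_iff_normalized:
  assumes "v \<noteq> 0" "h \<noteq> 0" "v' \<noteq> 0" "h' \<noteq> 0"
  shows "pcode v h s = pcode v' h' s' \<longleftrightarrow>
    inverse (leading v) *s v = inverse (leading v') *s v' \<and>
    inverse (leading h) *s h = inverse (leading h') *s h' \<and>
    inverse (leading v) * inverse (leading h) * s = inverse (leading v') * inverse (leading h') * s'"
    (is "_ \<longleftrightarrow> ?N")
proof
  assume "pcode v h s = pcode v' h' s'"
  then obtain l m where "l \<noteq> 0" "m \<noteq> 0" "v' = l *s v" "h' = m *s h" "s' = l * m * s"
    using pcode_eq_iff[OF assms] by blast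
  then show ?N
    by (simp add: leading_scale field_simps)
next
  assume ?N
  have nz: "leading v \<noteq> 0" "leading h \<noteq> 0" "leading v' \<noteq> 0" "leading h' \<noteq> 0"
    using assms by (simp_all add: leading_eq_0_iff)
  have cancel: "y = (b / a) *s x" if "inverse a *s x = inverse b *s y" "b \<noteq> 0"
    for a b :: f5 and x y :: "f5 ^ 3"
  proof -
    have "b *s (inverse a *s x) = b *s (inverse b *s y)"
      using that by simp
    then show ?thesis
      using that(2) by (simp add: divide_inverse)
  qed
  have "v' = (leading v' / leading v) *s v" "h' = (leading h' / leading h) *s h"
    using \<open>?N\<close> nz by (blast intro: cancel)+
  moreover have "s' = (leading v' / leading v) * (leading h' / leading h) * s"
    using \<open>?N\<close> nz by (simp add: field_simps)
  ultimately show "pcode v h s = pcode v' h' s'"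
    unfolding pcode_eq_iff[OF assms] using nz
    by (intro exI[of _ "leading v' / leading v"] exI[of _ "leading h' / leading h"]) simp
qed

fun lead :: "vec3 \<Rightarrow> z5" where
  "lead (x, y, z) = (if x \<noteq> Z0 then x else if y \<noteq> Z0 then y else z)"

lemma leading_vec_of: "leading (vec_of x) = emb (lead x)"
  by (cases x) (simp add: leading_def)

fun nf :: "param \<Rightarrow> param" where
  "nf (v, h, s) = (scale (inv5 (lead v)) v, scale (inv5 (lead h)) h, inv5 (lead v) * inv5 (lead h) * s)"

lemma proper_iff:
  "proper (v, h, s) \<longleftrightarrow> vec_of v \<noteq> 0 \<and> vec_of h \<noteq> 0 \<and>
     vec_of v \<star> vec_of v = 0 \<and> vec_of h \<star> vec_of v = 0"
  by (simp add: vec_of_eq_0_iff vec_of_dot_eq_0_iff)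

text \<open>This makes equality of codes decidable by evaluation.\<close>

lemma param_code_eq_iff:
  assumes "proper t" "proper t'"
  shows "param_code t = param_code t' \<longleftrightarrow> nf t = nf t'"
proof -
  obtain v h s v' h' s' where t: "t = (v, h, s)" "t' = (v', h', s')"
    by (cases t; cases t')
  have "vec_of v \<noteq> 0" "vec_of h \<noteq> 0" "vec_of v' \<noteq> 0" "vec_of h' \<noteq> 0"
    using assms by (simp_all add: t proper_iff del: proper.simps)
  then show ?thesis
    unfolding t param_code.simps nf.simps prod.inject vec_of_eq_iff[symmetric] emb_eq_iff[symmetric]
    by (simp only: pcode_eq_iff_normalized leading_vec_of vec_of_scale emb_inv5 emb_times simp_thms)
qed

text \<open>The vectors v are the 6 points of the conic v . v = 0, the h are the 6 points on the
  tangent line at v, and s is arbitrary, which gives 180 entries.\<close>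

definition normals :: "param list" where
  "normals = concat (map (\<lambda>v. List.product [v]
       (List.product (filter (\<lambda>h. dot h v = Z0) (filter (\<lambda>h. lead h = Z1) all_vec3)) all_z5))
     (filter (\<lambda>v. lead v = Z1 \<and> dot v v = Z0) all_vec3))"

lemma lead_normalized:
  assumes "vec_of x \<noteq> 0"
  shows "lead (scale (inv5 (lead x)) x) = Z1"
proof -
  have "leading (vec_of (scale (inv5 (lead x)) x)) = 1"
    using assms by (simp add: vec_of_scale leading_scale leading_eq_0_iff flip: leading_vec_of)
  then show ?thesis
    unfolding leading_vec_of using emb_eq_iff[of _ Z1] by simp
qed

text \<open>Both defining equations are homogeneous and survive the scaling.\<close>

lemma nf_in_normals:
  assumes "proper t"
  shows "nf t \<in> set normals"
proof -
  obtain v h s where t: "t = (v, h, s)"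
    by (cases t)
  have "dot (scale k v) (scale k v) = Z0" "dot (scale l h) (scale k v) = Z0" for k l
    using assms
    by (simp_all add: t proper_iff vec_of_scale scalar_product_scale_left scalar_product_scale_right
        flip: vec_of_dot_eq_0_iff del: proper.simps)
  moreover have "vec_of v \<noteq> 0" "vec_of h \<noteq> 0"
    using assms by (simp_all add: t proper_iff del: proper.simps)
  ultimately show ?thesis
    unfolding t normals_def
    by (simp add: lead_normalized del: split_paired_Ex)
      (rule exI[of _ "scale (inv5 (lead v)) v"], simp add: lead_normalized)
qed

section \<open>The monomial matrices of size three\<close>

type_synonym mat3 = "vec3 \<times> vec3 \<times> vec3"

definition units :: "vec3 list" where
  "units = [(Z1, Z0, Z0), (Z4, Z0, Z0), (Z0, Z1, Z0), (Z0, Z4, Z0), (Z0, Z0, Z1), (Z0, Z0, Z4)]"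

fun orthogonal_rows :: "mat3 \<Rightarrow> bool" where
  "orthogonal_rows (a, b, c) \<longleftrightarrow> dot a b = Z0 \<and> dot a c = Z0 \<and> dot b c = Z0"

text \<open>By the row criterion for monomial matrices, orthogonality selects the 6 * 4 * 2 = 48
  signed permutation matrices among the 216 triples of signed unit vectors.\<close>

definition monomials :: "mat3 list" where
  "monomials = filter orthogonal_rows (List.product units (List.product units units))"

fun mat_of :: "mat3 \<Rightarrow> f5 ^ 3 ^ 3" where
  "mat_of (a, b, c) = vector [vec_of a, vec_of b, vec_of c]"

fun mul3 :: "vec3 \<Rightarrow> mat3 \<Rightarrow> vec3" where
  "mul3 (x, y, z) ((a, b, c), (d, e, f), (g, h, i)) =
     (x * a + y * d + z * g, x * b + y * e + z * h, x * c + y * f + z * i)"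

lemma vec_of_units: "x \<in> vec_of ` set units \<longleftrightarrow> (\<exists>j. \<exists>e\<in>{1, -1}. x = axis j e)"
proof -
  have ex: "(\<exists>j::3. P j) \<longleftrightarrow> P 1 \<or> P 2 \<or> P 3" for P
    by (metis exhaust_3)
  have "(4 :: f5) = - 1"
    using five_eq_0 by (simp add: eq_neg_iff_add_eq_0)
  then have vec_of: "vec_of (Z1, Z0, Z0) = axis 1 1" "vec_of (Z4, Z0, Z0) = axis 1 (-1)"
    "vec_of (Z0, Z1, Z0) = axis 2 1" "vec_of (Z0, Z4, Z0) = axis 2 (-1)"
    "vec_of (Z0, Z0, Z1) = axis 3 1" "vec_of (Z0, Z0, Z4) = axis 3 (-1)"
    by (simp_all add: vec_eq_iff forall_3 axis_def)
  show ?thesis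
    unfolding ex by (auto simp: units_def vec_of)
qed

lemma monomials_eq: "{M. monomial M} = mat_of ` set monomials"
proof (intro equalityI subsetI)
  fix M :: "f5 ^ 3 ^ 3"
  assume "M \<in> {M. monomial M}"
  then have "monomial M"
    by simp
  then have M: "\<And>i. M $ i \<in> vec_of ` set units" "\<And>i k. i \<noteq> k \<Longrightarrow> M $ i \<star> M $ k = 0"
    unfolding vec_of_units monomial_iff_rows by blast+
  obtain a b c where abc: "a \<in> set units" "b \<in> set units" "c \<in> set units"
    "M $ 1 = vec_of a" "M $ 2 = vec_of b" "M $ 3 = vec_of c"
    using M(1)[of 1] M(1)[of 2] M(1)[of 3] unfolding image_iff by blast
  have "vec_of a \<star> vec_of b = 0" "vec_of a \<star> vec_of c = 0" "vec_of b \<star> vec_of c = 0"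
    unfolding abc(4-6)[symmetric] by (rule M(2), simp)+
  then have "(a, b, c) \<in> set monomials"
    unfolding monomials_def set_filter set_product vec_of_dot_eq_0_iff using abc(1-3) by simp
  moreover have "M = mat_of (a, b, c)"
    by (simp add: vec_eq_iff[of M] forall_3 abc)
  ultimately show "M \<in> mat_of ` set monomials"
    by blast
next
  fix M
  assume "M \<in> mat_of ` set monomials"
  then obtain a b c where abc: "(a, b, c) \<in> set monomials" "M = mat_of (a, b, c)"
    by force
  have comm: "x \<star> y = y \<star> x" for x y :: "f5 ^ 3"
    by (simp add: scalar_product_def mult.commute)
  have "M $ i \<in> vec_of ` set units" for i
    using abc exhaust_3[of i] by (auto simp: monomials_def)
  then have "\<forall>i. \<exists>j. \<exists>e\<in>{1, -1}. M $ i = axis j e"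
    unfolding vec_of_units ..
  moreover have "\<forall>i k. i \<noteq> k \<longrightarrow> M $ i \<star> M $ k = 0"
  proof -
    have "vec_of a \<star> vec_of b = 0" "vec_of a \<star> vec_of c = 0" "vec_of b \<star> vec_of c = 0"
      using abc(1) by (simp_all add: monomials_def vec_of_dot_eq_0_iff)
    then show ?thesis
      using comm[of "vec_of a" "vec_of b"] comm[of "vec_of a" "vec_of c"] comm[of "vec_of b" "vec_of c"]
      by (simp add: abc(2) forall_3)
  qed
  ultimately show "M \<in> {M. monomial M}"
    by (simp add: monomial_iff_rows)
qed

lemma distinct_monomials: "distinct monomials"
proof -
  have "distinct units"
    by (simp add: units_def)
  then show ?thesis
    by (simp add: monomials_def distinct_product)
qed

lemma inj_on_mat_of: "inj_on mat_of (set monomials)"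
proof (rule inj_onI)
  fix m n
  assume "m \<in> set monomials" "n \<in> set monomials" and eq: "mat_of m = mat_of n"
  moreover obtain a b c a' b' c' where "m = (a, b, c)" "n = (a', b', c')"
    by (metis prod_cases3)
  ultimately show "m = n"
    by (simp add: vec_eq_iff[of "vector _"] forall_3)
qed

lemma vec_of_mul3: "vec_of (mul3 x m) = vec_of x v* mat_of m"
  by (cases "(x, m)" rule: mul3.cases) (simp add: vec_eq_iff forall_3 vector_matrix_mult_def sum_3)

fun act :: "param \<Rightarrow> mat3 \<Rightarrow> param" where
  "act (v, h, s) m = (mul3 v m, mul3 h m, s)"

lemma monomial_mat_of: "m \<in> set monomials \<Longrightarrow> monomial (mat_of m)"
  using monomials_eq by blast

lemma param_code_act:
  "m \<in> set monomials \<Longrightarrow> (\<lambda>c. mat_act c (mat_of m)) ` param_code t = param_code (act t m)"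
  by (cases t) (simp add: vec_of_mul3 pcode_image monomial_mat_of)

lemma proper_act:
  assumes "m \<in> set monomials" "proper t"
  shows "proper (act t m)"
proof -
  have "x v* mat_of m = 0 \<Longrightarrow> x = 0" for x
    using vector_matrix_transpose_cancel(1)[OF monomial_mat_of[OF assms(1)], of x]
    by (metis vector_matrix_mult_0)
  with assms(2) show ?thesis
    by (cases t) (auto simp: proper_iff vec_of_mul3 monomial_isometry monomial_mat_of[OF assms(1)]
        simp del: proper.simps)
qed

text \<open>Repetitions are kept, one entry for each of the 48 matrices: membership decides
  equivalence, while the multiplicity of \<open>nf t\<close> is the order of the stabilizer.\<close>

definition orbit :: "param \<Rightarrow> param list" where
  "orbit t = map (\<lambda>m. nf (act t m)) monomials"

lemma monomially_equivalent_param_code: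
  assumes "proper t" "proper t'"
  shows "monomially_equivalent (param_code t) (param_code t') \<longleftrightarrow> nf t' \<in> set (orbit t)"
proof -
  have "monomially_equivalent (param_code t) (param_code t') \<longleftrightarrow>
      (\<exists>M\<in>{M. monomial M}. param_code t' = (\<lambda>c. mat_act c M) ` param_code t)"
    by (auto simp: monomially_equivalent_iff)
  also have "\<dots> \<longleftrightarrow> (\<exists>m\<in>set monomials. param_code t' = param_code (act t m))"
    by (simp add: monomials_eq param_code_act)
  also have "\<dots> \<longleftrightarrow> (\<exists>m\<in>set monomials. nf t' = nf (act t m))"
    using assms by (simp add: param_code_eq_iff proper_act)
  finally show ?thesis
    by (auto simp: orbit_def)
qed

lemma card_Aut_param_code:
  assumes "proper t"
  shows "card (Aut (param_code t)) = count_list (orbit t) (nf t)"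
proof -
  have "Aut (param_code t) = {M \<in> mat_of ` set monomials. (\<lambda>c. mat_act c M) ` param_code t = param_code t}"
    unfolding monomials_eq[symmetric] by (auto simp: Aut_def Setcompr_eq_image)
  also have "\<dots> = mat_of ` {m \<in> set monomials. (\<lambda>c. mat_act c (mat_of m)) ` param_code t = param_code t}"
    by blast
  also have "\<dots> = mat_of ` {m \<in> set monomials. nf (act t m) = nf t}"
    using assms by (simp add: param_code_act param_code_eq_iff proper_act cong: conj_cong)
  also have "card \<dots> = card {m \<in> set monomials. nf (act t m) = nf t}"
    by (intro card_image inj_on_subset[OF inj_on_mat_of]) auto
  also have "\<dots> = length (filter (\<lambda>m. nf (act t m) = nf t) monomials)"
    using distinct_length_filter[OF distinct_monomials] by (simp add: Int_def conj_commute)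
  also have "\<dots> = count_list (orbit t) (nf t)"
    by (simp add: orbit_def count_list_eq_length_filter filter_map comp_def eq_commute)
  finally show ?thesis .
qed

section \<open>Weights\<close>

fun wt :: "vec3 \<Rightarrow> vec3 \<Rightarrow> nat" where
  "wt (x1, x2, x3) (y1, y2, y3) =
     (if x1 = Z0 \<and> y1 = Z0 then 0 else 1) +
     (if x2 = Z0 \<and> y2 = Z0 then 0 else 1) +
     (if x3 = Z0 \<and> y3 = Z0 then 0 else 1)"

lemma weight_vec_of: "weight (i5vec (vec_of x) (vec_of y)) = wt x y"
proof -
  have "weight c = (\<Sum>i\<in>UNIV. of_bool (c $ i \<noteq> 0))" for c :: "i5 ^ 3"
    by (simp add: weight_def sum_of_bool_eq)
  then show ?thesis
    by (cases x; cases y) (simp add: sum_3 zero_i5_def )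
qed

text \<open>Filtering the product of the two lists directly would be quadratic in \<open>code_simp\<close>, which simplifies
  the remaining list anew for each conditional.\<close>

fun weights :: "param \<Rightarrow> nat list" where
  "weights (v, h, s) =
     concat (map (\<lambda>k. map (wt (scale k v)) (filter (\<lambda>y. dot h y = k * s) all_vec3)) all_z5)"

lemma filter_product:
  "filter (\<lambda>(x, y). P x y) (List.product xs ys) = concat (map (\<lambda>x. map (Pair x) (filter (P x) ys)) xs)"
  by (induction xs) (simp_all add: filter_map comp_def)

text \<open>Each codeword is listed once, by its factor k of v and its \<open>\<b>\<close>-part y; k
  is unique because v is nonzero. Cardinalities thereby become counts in a list.\<close>

lemma param_code_weights:
  assumes "proper t"
  obtains W and I :: "(z5 \<times> vec3) list" where
    "distinct I" "inj_on W (set I)" "param_code t = W ` set I" "weights t = map (\<lambda>i. weight (W i)) I"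
proof -
  obtain v h s where t: "t = (v, h, s)"
    by (cases t)
  define W where "W = (\<lambda>(k, y). i5vec (emb k *s vec_of v) (vec_of y))"
  define I where "I = filter (\<lambda>(k, y). dot h y = k * s) (List.product all_z5 all_vec3)"
  have "distinct I"
    by (simp add: I_def distinct_product distinct_all_z5 distinct_all_vec3)
  moreover have "vec_of v \<noteq> 0"
    using assms by (simp add: t vec_of_eq_0_iff)
  then have "inj_on W (set I)"
    by (auto simp: inj_on_def W_def)
  moreover have "param_code t = W ` set I"
  proof (rule equalityI)
    have eq: "vec_of h \<star> vec_of y = emb k * emb s \<longleftrightarrow> dot h y = k * s" for y k
      by (simp add: vec_of_dot flip: emb_times)
    show "W ` set I \<subseteq> param_code t"
    proof (rule image_subsetI)
      fix i
      assume "i \<in> set I"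
      moreover obtain k y where i: "i = (k, y)"
        by (cases i)
      ultimately have "dot h y = k * s"
        by (simp add: I_def)
      then show "W i \<in> param_code t"
        unfolding i W_def t param_code.simps case_prod_conv i5vec_in_pcode using eq by blast
    qed
    show "param_code t \<subseteq> W ` set I"
    proof
      fix c
      assume "c \<in> param_code t"
      then obtain l z where "c = i5vec (l *s vec_of v) z" "vec_of h \<star> z = l * emb s"
        by (auto simp: t pcode_def)
      moreover obtain k y where "l = emb k" "z = vec_of y"
        using vec_of_surj emb_surj by metis
      ultimately have "c = W (k, y)" "(k, y) \<in> set I"
        by (simp_all add: W_def I_def eq)
      then show "c \<in> W ` set I"
        by blast
    qed
  qed
  moreover have "weights t = map (\<lambda>i. weight (W i)) I"
    by (simp add: t I_def W_def filter_product map_concat comp_def weight_vec_of flip: vec_of_scale)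
  ultimately show ?thesis
    by (rule that)
qed

section \<open>Cardinality, weight distribution and minimum distance\<close>

lemma card_param_code:
  assumes "proper t"
  shows "card (param_code t) = length (weights t)"
  using param_code_weights[OF assms] by (metis card_image distinct_card length_map)

lemma num_weight_param_code:
  assumes "proper t"
  shows "num_weight (param_code t) w = count_list (weights t) w"
proof -
  obtain W and I :: "(z5 \<times> vec3) list" where *: "distinct I" "inj_on W (set I)" "param_code t = W ` set I"
      "weights t = map (\<lambda>i. weight (W i)) I"
    by (rule param_code_weights[OF assms])
  have "{c \<in> param_code t. weight c = w} = W ` {i \<in> set I. weight (W i) = w}"
    by (auto simp: *)
  then have "num_weight (param_code t) w = card {i \<in> set I. weight (W i) = w}"
    unfolding num_weight_def by (simp add: card_image inj_on_subset[OF *(2)])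
  also have "\<dots> = length (filter (\<lambda>i. weight (W i) = w) I)"
    using distinct_length_filter[OF *(1)] by (simp add: Int_def conj_commute)
  also have "\<dots> = count_list (weights t) w"
    by (simp add: * count_list_eq_length_filter filter_map comp_def eq_commute)
  finally show ?thesis .
qed

lemma weight_eq_0_iff: "weight c = 0 \<longleftrightarrow> c = 0"
  by (auto simp: weight_def vec_eq_iff)

lemma min_dist_eqI:
  fixes C :: "(i5 ^ 'n) set"
  assumes "num_weight C d > 0" "d > 0" "\<And>w. 0 < w \<Longrightarrow> w < d \<Longrightarrow> num_weight C w = 0"
  shows "min_dist C = d"
  unfolding min_dist_def
proof (rule Least_equality)
  have "{c \<in> C. weight c = d} \<noteq> {}"
    using assms(1) unfolding num_weight_def by (metis card.empty less_irrefl)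
  then obtain c where "c \<in> C" "weight c = d"
    by blast
  moreover from this have "c \<noteq> 0"
    using assms(2) by (metis weight_eq_0_iff less_irrefl)
  ultimately show "\<exists>c\<in>C. c \<noteq> 0 \<and> weight c = d"
    by blast
next
  fix w
  assume "\<exists>c\<in>C. c \<noteq> 0 \<and> weight c = w"
  then obtain c where c: "c \<in> C" "c \<noteq> 0" "weight c = w"
    by blast
  show "d \<le> w"
  proof (rule ccontr)
    assume "\<not> d \<le> w"
    moreover have "w > 0"
      using c weight_eq_0_iff by blast
    ultimately have "card {c \<in> C. weight c = w} = 0"
      using assms(3)[of w] by (simp add: num_weight_def)
    \<comment> \<open>Cardinality 0 implies emptiness only for finite sets, since infinite sets also
      have \<open>card\<close> equal to 0.\<close>
    moreover have "finite {c \<in> C. weight c = w}"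
    proof (rule finite_subset)
      show "{c \<in> C. weight c = w} \<subseteq> range (\<lambda>(x, y). i5vec x y)"
      proof
        fix c :: "i5 ^ 'n"
        show "c \<in> range (\<lambda>(x, y). i5vec x y)"
          by (cases c) auto
      qed
    qed simp
    ultimately show False
      using c by simp
  qed
qed

section \<open>The ten codes\<close>

text \<open>A triple \<open>(v, w, u)\<close> stands for the generator matrix with rows \<open>\<a>v + \<b>w\<close> and \<open>\<b>u\<close>.\<close>

definition gens :: "(vec3 \<times> vec3 \<times> vec3) list" where
  "gens = [((Z0, Z1, Z3), (Z0, Z0, Z0), (Z1, Z2, Z1)),
    ((Z1, Z2, Z0), (Z0, Z1, Z3), (Z1, Z2, Z1)),
    ((Z1, Z2, Z0), (Z0, Z2, Z1), (Z1, Z2, Z1)),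
    ((Z1, Z2, Z0), (Z0, Z0, Z1), (Z0, Z1, Z0)),
    ((Z1, Z2, Z0), (Z0, Z0, Z0), (Z0, Z1, Z0)),
    ((Z1, Z0, Z2), (Z0, Z0, Z0), (Z0, Z1, Z1)),
    ((Z1, Z2, Z0), (Z0, Z0, Z1), (Z0, Z1, Z1)),
    ((Z1, Z2, Z0), (Z0, Z0, Z1), (Z0, Z1, Z3)),
    ((Z1, Z2, Z0), (Z0, Z0, Z1), (Z0, Z1, Z4)),
    ((Z1, Z2, Z0), (Z0, Z0, Z2), (Z0, Z1, Z1))]"

text \<open>The torsion code is the plane spanned by v and u, whose normal vector is the cross
  product; s is its product with the lift w of v.\<close>

fun param_of :: "vec3 \<times> vec3 \<times> vec3 \<Rightarrow> param" where
  "param_of (v, w, u) = (v, cross v u, dot (cross v u) w)"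

text \<open>A nonzero cross product means that v and u are independent, so they span the whole plane
  orthogonal to it.\<close>

lemma code_eq_param_code:
  fixes G :: "i5 ^ 3 ^ 2"
  assumes G: "G $ 1 = i5vec (vec_of v) (vec_of w)" "G $ 2 = i5vec 0 (vec_of u)" and nz: "cross v u \<noteq> zero3"
  shows "code G = param_code (param_of (v, w, u))"
proof -
  let ?h = "vec_of (cross v u)"
  obtain v1 v2 v3 u1 u2 u3 where vu: "v = (v1, v2, v3)" "u = (u1, u2, u3)"
    by (cases v; cases u)
  have orth: "?h \<star> vec_of v = 0" "?h \<star> vec_of u = 0"
    by (simp_all add: vu scalar_product_def sum_3 algebra_simps)
  have "?h \<noteq> 0"
    using nz by (simp add: vec_of_eq_0_iff)
  have "vec_of u \<noteq> 0"
  proof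
    assume "vec_of u = 0"
    then have "?h = 0"
      by (simp add: vu vec_eq_iff forall_3)
    with \<open>?h \<noteq> 0\<close> show False ..
  qed
  moreover have "vec_of v \<notin> vec.span {vec_of u}"
  proof
    assume "vec_of v \<in> vec.span {vec_of u}"
    then obtain k where "vec_of v = k *s vec_of u"
      by (auto simp: vec.span_singleton)
    then have "?h = 0"
      by (simp add: vu vec_eq_iff forall_3)
    with \<open>?h \<noteq> 0\<close> show False ..
  qed
  ultimately have "vec.dim {vec_of v, vec_of u} = 2"
    by (simp add: vec.dim_insert)
  moreover have "vec.dim {y. ?h \<star> y = 0} = 2"
    using dim_hyperplane[OF \<open>?h \<noteq> 0\<close>] by simp
  moreover have "{vec_of v, vec_of u} \<subseteq> {y. ?h \<star> y = 0}"
    using orth by simp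
  \<comment> \<open>Both sides have dimension 2 and one generating set lies in the other.\<close>
  ultimately have "vec.span {vec_of v, vec_of u} = vec.span {y. ?h \<star> y = 0}"
    by (intro vec.dim_eq_span) simp_all
  then have "{y. ?h \<star> y = 0} \<subseteq> vec.span {vec_of v, vec_of u}"
    using vec.span_superset by metis
  then show ?thesis
    using code_eq_pcode[OF G orth] by (simp add: vec_of_dot)
qed

definition reps :: "param list" where "reps = map param_of gens"

lemma codes_eq: "codes = map param_code reps"
proof -
  have generators: "\<forall>(v, w, u)\<in>set gens. cross v u \<noteq> zero3"
    by code_simp
  \<comment> \<open>One rule for all ten matrices, with the shape of G as an equation that is
    checked entry by entry.\<close>
  have code_eq: "code G = param_code (param_of g)"
    if "g \<in> set gens"
      "G = vector [i5vec (vec_of (fst g)) (vec_of (fst (snd g))), i5vec 0 (vec_of (snd (snd g)))]"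
    for g and G :: "i5 ^ 3 ^ 2"
  proof -
    obtain v w u where "g = (v, w, u)"
      by (cases g)
    with that generators have "G $ 1 = i5vec (vec_of v) (vec_of w)" "G $ 2 = i5vec 0 (vec_of u)" "cross v u \<noteq> zero3"
      by auto
    then show ?thesis
      unfolding \<open>g = (v, w, u)\<close> by (rule code_eq_param_code)
  qed
  note defs = G1_def G2_def G3_def G4_def G5_def G6_def G7_def G8_def G9_def G10_def
  show ?thesis
    unfolding codes_def reps_def gens_def list.map list.inject
    by (intro conjI code_eq)
       (simp_all add: gens_def defs vec_eq_iff forall_2 forall_3
         \<a>_def \<b>_def scal_def plus_i5_def zero_i5_def)
qed

section \<open>Finite checks by evaluation\<close>

lemma proper_reps: "list_all proper reps"
  by code_simp

text \<open>One table settles all 100 pairs: off the diagonal it expresses inequivalence, on it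
  reflexivity.\<close>

lemma reps_inequivalent:
  "map (\<lambda>t. map (List.member (orbit t)) (map nf reps)) reps =
    map (\<lambda>i. map (\<lambda>j. i = j) [0..<10]) [0..<10]"
  by code_simp

text \<open>Completeness of the classification: no normal form lies outside the ten orbits.\<close>

lemma reps_cover: "list_all (\<lambda>t. list_ex (\<lambda>xs. t \<in> set xs) (map orbit reps)) normals"
  by code_simp

lemma reps_Aut: "map (\<lambda>t. count_list (orbit t) (nf t)) reps = [8, 4, 4, 2, 8, 2, 2, 2, 2, 2]"
  by code_simp

text \<open>For each of the 5 multiples of v, the \<open>\<b>\<close>-parts form a coset of a plane
  with 25 points.\<close>

lemma reps_length: "list_all (\<lambda>t. length (weights t) = 125) reps"
  by code_simp

lemma reps_weights:
  "map (\<lambda>t. map (count_list (weights t)) [1, 2, 3]) reps =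
    [[4, 24, 96], [4, 24, 96], [4, 24, 96], [8, 16, 100], [8, 116, 0],
     [0, 32, 92], [0, 32, 92], [0, 32, 92], [0, 32, 92], [0, 32, 92]]"
  by code_simp

section \<open>From the tables to the ten codes\<close>

lemma proper_rep: "t \<in> set reps \<Longrightarrow> proper t"
  using proper_reps by (simp add: list_all_iff)

lemma length_reps: "length reps = 10"
  by (simp add: reps_def gens_def)

lemma nth_codes: "i < 10 \<Longrightarrow> codes ! i = param_code (reps ! i)"
  by (simp add: codes_eq length_reps)

lemma qsd_type_codes:
  assumes "C \<in> set codes"
  shows "quasi_self_dual C" "has_type C 1 1"
proof -
  obtain t where rep: "t \<in> set reps" "C = param_code t"
    using assms by (auto simp: codes_eq simp del: split_paired_Ex)
  then have "card C = 125"
    using reps_length card_param_code proper_rep by (simp add: list_all_iff)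
  obtain v h s where t: "t = (v, h, s)"
    by (cases t)
  then have C: "C = pcode (vec_of v) (vec_of h) (emb s)" and "proper (v, h, s)"
    using rep proper_rep[of t] by (simp_all only: param_code.simps)
  then have "vec_of v \<noteq> 0" "vec_of h \<noteq> 0" "vec_of v \<star> vec_of v = 0" "vec_of h \<star> vec_of v = 0"
    by (simp_all add: proper_iff del: proper.simps)
  then show "quasi_self_dual C" "has_type C 1 1"
    using has_type_pcode[of "vec_of v" "vec_of h" "emb s"] \<open>card C = 125\<close>
    by (simp_all add: C quasi_self_dual_def linear_pcode self_orthogonal_pcode)
qed

lemma codes_equivalent_iff:
  assumes "i < 10" "j < 10"
  shows "monomially_equivalent (codes ! i) (codes ! j) \<longleftrightarrow> i = j"
proof -
  have "map (\<lambda>t. map (List.member (orbit t)) (map nf reps)) reps ! i ! j = (i = j)"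
    unfolding reps_inequivalent using assms by simp
  then have "nf (reps ! j) \<in> set (orbit (reps ! i)) \<longleftrightarrow> i = j"
    using assms length_reps by simp
  then show ?thesis
    using assms length_reps by (simp add: nth_codes monomially_equivalent_param_code proper_rep)
qed

lemma codes_cover:
  assumes "quasi_self_dual C" "has_type C 1 1"
  shows "\<exists>C'\<in>set codes. monomially_equivalent C C'"
proof -
  obtain t where t: "proper t" "C = param_code t"
    using qsd_type_param_code[OF assms] by blast
  then obtain r where r: "r \<in> set reps" "nf t \<in> set (orbit r)"
    using nf_in_normals[OF t(1)] reps_cover
    by (auto simp: list_all_iff list_ex_iff simp del: split_paired_Ex)
  \<comment> \<open>The orbit starts at the representative, so the equivalence has to be reversed
    afterwards.\<close>
  then have "monomially_equivalent (param_code r) C"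
    using t proper_rep by (simp add: monomially_equivalent_param_code)
  then have "monomially_equivalent C (param_code r)"
    using equivE[OF equiv_monomially_equivalent] by (blast dest: symD)
  then show ?thesis
    using r(1) by (auto simp: codes_eq)
qed

lemma codes_num_weight:
  "map (\<lambda>C. (num_weight C 1, num_weight C 2, num_weight C 3)) codes =
    [(4, 24, 96), (4, 24, 96), (4, 24, 96), (8, 16, 100), (8, 116, 0),
     (0, 32, 92), (0, 32, 92), (0, 32, 92), (0, 32, 92), (0, 32, 92)]"
proof -
  have "map (\<lambda>C. (num_weight C 1, num_weight C 2, num_weight C 3)) codes =
      map (\<lambda>xs. (xs ! 0, xs ! 1, xs ! 2)) (map (\<lambda>t. map (count_list (weights t)) [1, 2, 3]) reps)"
    by (simp add: codes_eq num_weight_param_code proper_rep)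
  also have "\<dots> = [(4, 24, 96), (4, 24, 96), (4, 24, 96), (8, 16, 100), (8, 116, 0),
     (0, 32, 92), (0, 32, 92), (0, 32, 92), (0, 32, 92), (0, 32, 92)]"
    unfolding reps_weights by simp
  finally show ?thesis .
qed

text \<open>Every one of the codes has a word of weight 1 or 2, so whether weight 1 occurs decides
  the minimum distance.\<close>

lemma codes_min_dist: "map min_dist codes = [1, 1, 1, 1, 1, 2, 2, 2, 2, 2]"
proof -
  have min_dist: "min_dist C = (if num_weight C 1 > 0 then 1 else 2)"
    if "num_weight C 1 > 0 \<or> num_weight C 2 > 0" for C :: "(i5 ^ 3) set"
  proof (rule min_dist_eqI)
    fix w
    assume "0 < w" "w < (if num_weight C 1 > 0 then 1 else 2 :: nat)"
    then have "w = 1" "num_weight C 1 = 0"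
      by (auto split: if_splits)
    then show "num_weight C w = 0"
      by simp
  qed (use that in auto)
  let ?ws = "\<lambda>C. (num_weight C 1, num_weight C 2, num_weight C 3)"
  have "list_all (\<lambda>(a, b, c). a > 0 \<or> b > 0) (map ?ws codes)"
    unfolding codes_num_weight by simp
  then have "map min_dist codes = map (\<lambda>(a, b, c). if a > 0 then 1 else 2) (map ?ws codes)"
    by (simp add: list_all_iff min_dist)
  also have "\<dots> = [1, 1, 1, 1, 1, 2, 2, 2, 2, 2]"
    unfolding codes_num_weight by simp
  finally show ?thesis .
qed

lemma codes_Aut: "map (\<lambda>C. card (Aut C)) codes = [8, 4, 4, 2, 8, 2, 2, 2, 2, 2]"
  unfolding reps_Aut[symmetric] by (simp add: codes_eq card_Aut_param_code proper_rep)

text \<open>Sending an index to the class of its representative is a bijection from ten indices to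
  the classes: onto because the representatives cover all codes, injective because they are
  inequivalent.\<close>

lemma card_quotient:
  "card ({C :: (i5 ^ 3) set. quasi_self_dual C \<and> has_type C 1 1} //
    {(C, C'). monomially_equivalent C C'}) = 10"
proof -
  let ?R = "{(C, C'). monomially_equivalent C C'} :: ((i5 ^ 3) set \<times> (i5 ^ 3) set) set"
  let ?X = "{C :: (i5 ^ 3) set. quasi_self_dual C \<and> has_type C 1 1}"
  have len: "length codes = 10"
    by (simp add: codes_def)
  have class_eq: "?R `` {C} = ?R `` {C'} \<longleftrightarrow> monomially_equivalent C C'" for C C'
    using eq_equiv_class_iff[OF equiv_monomially_equivalent] by simp
  have "?X // ?R = (\<lambda>i. ?R `` {codes ! i}) ` {..<10}"
  proof (intro equalityI subsetI)
    fix Q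
    assume "Q \<in> ?X // ?R"
    then obtain C where C: "C \<in> ?X" "Q = ?R `` {C}"
      by (rule quotientE)
    then obtain C' where "C' \<in> set codes" "monomially_equivalent C C'"
      using codes_cover by blast
    moreover from this obtain i where "i < 10" "C' = codes ! i"
      by (metis in_set_conv_nth len)
    ultimately show "Q \<in> (\<lambda>i. ?R `` {codes ! i}) ` {..<10}"
      using C(2) class_eq by (intro image_eqI[of _ _ i]) simp_all
  next
    fix Q
    assume "Q \<in> (\<lambda>i. ?R `` {codes ! i}) ` {..<10}"
    then obtain i where "i < 10" "Q = ?R `` {codes ! i}"
      by blast
    moreover from this have "codes ! i \<in> ?X"
      using qsd_type_codes len by simp
    ultimately show "Q \<in> ?X // ?R"
      by (simp only: quotientI)
  qed
  moreover have "inj_on (\<lambda>i. ?R `` {codes ! i}) {..<10}"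
    using codes_equivalent_iff class_eq by (simp add: inj_on_def)
  ultimately show ?thesis
    by (simp add: card_image)
qed

theorem mainTheorem7:
  shows "card ({C :: (i5 ^ 3) set. quasi_self_dual C \<and> has_type C 1 1} //
               {(C, C'). monomially_equivalent C C'}) = 10 \<and>
    (\<forall>C \<in> set codes. quasi_self_dual C \<and> has_type C 1 1) \<and>
    (\<forall>i < 10. \<forall>j < 10. i \<noteq> j \<longrightarrow> \<not> monomially_equivalent (codes ! i) (codes ! j)) \<and>
    (\<forall>C :: (i5 ^ 3) set. quasi_self_dual C \<and> has_type C 1 1 \<longrightarrow>
       (\<exists>C' \<in> set codes. monomially_equivalent C C')) \<and>
    map (\<lambda>C. card (Aut C)) codes = [8, 4, 4, 2, 8, 2, 2, 2, 2, 2] \<and>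
    map min_dist codes = [1, 1, 1, 1, 1, 2, 2, 2, 2, 2] \<and>
    map (\<lambda>C. (num_weight C 1, num_weight C 2, num_weight C 3)) codes =
      [(4, 24, 96), (4, 24, 96), (4, 24, 96), (8, 16, 100), (8, 116, 0),
       (0, 32, 92), (0, 32, 92), (0, 32, 92), (0, 32, 92), (0, 32, 92)]"
  using card_quotient qsd_type_codes codes_equivalent_iff codes_cover codes_Aut codes_min_dist codes_num_weight
  by blast

end
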